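(* Let $f_d$ and $\|\cdot\|$ be any two norms on $\mathbb{R}^N$ and $(\psi_i)_{i\in I}$ be a dictionary in $\mathbb{R}^N$. Let $\tau>0$ and $\theta$ be such that $\theta\ge\tau\max_{0\le K\le N}\Delta_K$. Consider a random variable $d$ with uniform distribution on $\mathcal{L}_{f_d}(\theta)$. Then $$N-\sum_{K=0}^{N-1}\frac{\overline{C}_K}{\mathbb{L}^N(\mathcal{L}_{f_d}(1))}\left(\frac{\tau}{\theta}\right)^{N-K}\left(1+\hat\delta_K\frac{\tau}{\theta}\right)^K\ \le\ \mathbb{E}\left(\mathrm{val}(\mathcal{P}_d)\right)$$ and $$\mathbb{E}\left(\mathrm{val}(\mathcal{P}_d)\right)\ \le\ N-\sum_{K=0}^{N-1}\left[\frac{\overline{C}_K}{\mathbb{L}^N(\mathcal{L}_{f_d}(1))}\left(\frac{\tau}{\theta}\right)^{N-K}\left(1-\hat\delta_K\frac{\tau}{\theta}\right)^K-\frac{\varepsilon_0(K,\tau,\theta)}{\mathbb{L}^N(\mathcal{L}_{f_d}(1))}\right].$$ Moreover, we have the following asymptotic result: $$\mathbb{E}\left(\mathrm{val}(\mathcal{P}_d)\right)=N-\frac{\overline{C}_{N-1}}{\mathbb{L}^N(\mathcal{L}_{f_d}(1))}\,\frac{\tau}{\theta}+o\left(\frac{\tau}{\theta}\right)\quad\text{as }\frac{\tau}{\theta}\to0.$$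
   Context: $N\ge1$ is an integer; $\|\cdot\|$ and $f_d$ are arbitrary norms on $\mathbb{R}^N$; $\|\cdot\|_2$ is the Euclidean norm; the dictionary $(\psi_i)_{i\in I}$ is a finite family in $\mathbb{R}^N$ with $\mathrm{span}\{\psi_i:i\in I\}=\mathbb{R}^N$. For $d\in\mathbb{R}^N$ and $\tau>0$, $\mathrm{val}(\mathcal{P}_d)$ is the minimum of $\#\{i\in I:\lambda_i\neq0\}$ over all $(\lambda_i)_{i\in I}\in\mathbb{R}^I$ with $\|\sum_{i\in I}\lambda_i\psi_i-d\|\le\tau$. For a function $f$, $\mathcal{L}_f(t)=\{w:f(w)\le t\}$. $P_V$ is the orthogonal projection onto a subspace $V$, $V^\bot$ the orthogonal complement. $\mathbb{L}^k$ is $k$-dimensional Lebesgue measure (on a $k$-dimensional subspace of $\mathbb{R}^N$, via identification with $\mathbb{R}^k$ by an orthonormal basis), with $\mathbb{L}^0(\{0\})=1$; zeroth powers equal $1$. For $J\subset I$: $\mathcal{T}_J=\mathrm{span}((\psi_j)_{j\in J})$ ($\mathrm{span}(\emptyset)=\{0\}$) and $\mathcal{T}_J^\tau=\mathcal{T}_J+P_{\mathcal{T}_J^\bot}(\mathcal{L}_{\|\cdot\|}(\tau))$. Constants. Fix $\delta_1,\delta_2>0$ with $f_d(w)\le\delta_1\|w\|_2$ and $\|w\|_2\le\delta_2\|w\|$ for all $w\in\mathbb{R}^N$, and let $\overline{\Delta}=\delta_1\delta_2$. For $J\subset I$, let $h_J$ be the norm on $\mathcal{T}_J^\bot$ given by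 $h_J(u)=\inf\{t>0:u/t\in P_{\mathcal{T}_J^\bot}(\mathcal{L}_{\|\cdot\|}(1))\}$; $\delta_J\in[0,\overline{\Delta}]$ is a fixed constant with $f_d(u)\le\delta_Jh_J(u)$ for all $u\in\mathcal{T}_J^\bot$; and, with $K=\dim\mathcal{T}_J$, $C_J=\mathbb{L}^{N-K}\big(P_{\mathcal{T}_J^\bot}(\mathcal{L}_{\|\cdot\|}(1))\big)\,\mathbb{L}^K\big(\mathcal{T}_J\cap\mathcal{L}_{f_d}(1)\big)$. $\mathcal{J}(K)$ is a fixed collection of subsets $J\subset I$ with $\dim\mathcal{T}_J=K$, such that distinct members have distinct spans $\mathcal{T}_J$ and every $K$-dimensional subspace of the form $\mathcal{T}_{J_1}$, $J_1\subset I$, equals $\mathcal{T}_J$ for some $J\in\mathcal{J}(K)$; $\mathcal{J}(0)=\{\emptyset\}$. Set $\hat\delta_K=\max_{J\in\mathcal{J}(K)}\delta_J$ and $\overline{C}_K=\sum_{J\in\mathcal{J}(K)}C_J$. Let $k_K=\max\{0,2K-N\}$ and $\mathcal{H}(K,k)=\{(J_1,J_2)\in\mathcal{J}(K)^2:\dim(\mathcal{T}_{J_1}\cap\mathcal{T}_{J_2})=k\}$ for $0\le k\le K-1$. For $(J_1,J_2)\in\mathcal{H}(K,k)$ put $W=\mathcal{T}_{J_1}\cap\mathcal{T}_{J_2}$ and $$Q_{J_1,J_2}=\mathbb{L}^{N-k}\big(W^\bot\cap\mathcal{L}_{\|\cdot\|_2}(2\delta_2)\big)\,\mathbb{L}^k\big(W\cap\mathcal{L}_{f_d}(1)\big),$$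 and let $\delta_{J_1,J_2}\in[0,3\overline{\Delta}]$ be a fixed constant such that for all $\tau,\theta>0$ with $\theta\ge\delta_{J_1,J_2}\tau$, $$\mathbb{L}^N\big(\mathcal{T}_{J_1}^\tau\cap\mathcal{T}_{J_2}^\tau\cap\mathcal{L}_{f_d}(\theta)\big)\le Q_{J_1,J_2}\tau^{N-k}(\theta+\delta_{J_1,J_2}\tau)^k.$$ For $1\le K\le N-1$ and $k_K\le k\le K-1$: $\hat\delta'_{K,k}=\max\{0,\max_{(J_1,J_2)\in\mathcal{H}(K,k)}\delta_{J_1,J_2}\}$ and $\overline{Q}_{K,k}=\sum_{(J_1,J_2)\in\mathcal{H}(K,k)}Q_{J_1,J_2}$ (both are $0$ if $\mathcal{H}(K,k)=\emptyset$). $\Delta_0=\hat\delta_0$; $\Delta_K=\max\{\Delta_{K-1},\hat\delta_K,\max_{k_K\le k\le K-1}\hat\delta'_{K,k}\}$ for $0<K<N$; $\Delta_N=\max\{\Delta_{N-1},\hat\delta_N\}$. $\varepsilon_0(K,\tau,\theta)=0$ if $K=0$ or $K=N$, and $\varepsilon_0(K,\tau,\theta)=\sum_{k=k_K}^{K-1}\overline{Q}_{K,k}\left(\frac{\tau}{\theta}\right)^{N-k}\left(1+\hat\delta'_{K,k}\frac{\tau}{\theta}\right)^k$ if $0<K<N$. In the asymptotic statement, $N$, the norms and the dictionary are fixed. *)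

theory Defs
  imports "HOL-Probability.Probability" "HOL-Library.Landau_Symbols"
begin

definition is_norm :: "('a::real_vector \<Rightarrow> real) \<Rightarrow> bool" where
  "is_norm f \<longleftrightarrow>
     (\<forall>x. 0 \<le> f x) \<and> (\<forall>x. f x = 0 \<longleftrightarrow> x = 0) \<and>
     (\<forall>a x. f (a *\<^sub>R x) = \<bar>a\<bar> * f x) \<and> (\<forall>x y. f (x + y) \<le> f x + f y)"

definition level :: "('a \<Rightarrow> real) \<Rightarrow> real \<Rightarrow> 'a set" where
  "level f t = {w. f w \<le> t}"

text \<open>Orthogonal projection onto \<open>V\<close>; meaningful when \<open>V\<close> is a subspace.\<close>

definition proj :: "'a::euclidean_space set \<Rightarrow> 'a \<Rightarrow> 'a" where
  "proj V x = (THE p. p \<in> V \<and> x - p \<in> V\<^sup>\<bottom>)"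

definition orthonormal_basis :: "'a::euclidean_space set \<Rightarrow> 'a set \<Rightarrow> bool" where
  "orthonormal_basis V B \<longleftrightarrow>
     pairwise orthogonal B \<and> (\<forall>b\<in>B. norm b = 1) \<and> span B = V"

text \<open>
  Lebesgue measure of dimension \<open>dim V\<close> on the subspace \<open>V\<close>, as a Borel measure on the ambient
  space concentrated on \<open>V\<close>: the image of the product Lebesgue measure on coordinates under the
  coordinate map of some orthonormal basis. For \<open>V = {0}\<close> the basis is empty, the product is a
  point mass, and the result is the Dirac measure at \<open>0\<close>. As with \<^const>\<open>lborel\<close>, no completion
  is taken; the sets measured below are all compact.
\<close>

definition subspace_lborel :: "'a::euclidean_space set \<Rightarrow> 'a measure" where
  "subspace_lborel V =
     (let B = (SOME B. orthonormal_basis V B)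
      in distr (\<Pi>\<^sub>M b\<in>B. lborel) borel (\<lambda>x. \<Sum>b\<in>B. x b *\<^sub>R b))"

text \<open>The optimal value of the sparse approximation problem for the data point \<open>d\<close>.\<close>

definition val_P ::
  "'i set \<Rightarrow> ('i \<Rightarrow> 'a::real_vector) \<Rightarrow> ('a \<Rightarrow> real) \<Rightarrow> real \<Rightarrow> 'a \<Rightarrow> nat" where
  "val_P I \<psi> nm \<tau> d =
     (LEAST m. \<exists>l :: 'i \<Rightarrow> real.
        nm ((\<Sum>i\<in>I. l i *\<^sub>R \<psi> i) - d) \<le> \<tau> \<and> m = card {i\<in>I. l i \<noteq> 0})"

definition T :: "('i \<Rightarrow> 'a::real_vector) \<Rightarrow> 'i set \<Rightarrow> 'a set" where
  "T \<psi> J = span (\<psi> ` J)"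

definition T_thick ::
  "('i \<Rightarrow> 'a::euclidean_space) \<Rightarrow> ('a \<Rightarrow> real) \<Rightarrow> real \<Rightarrow> 'i set \<Rightarrow> 'a set" where
  "T_thick \<psi> nm \<tau> J = {v + u | v u. v \<in> T \<psi> J \<and> u \<in> proj ((T \<psi> J)\<^sup>\<bottom>) ` level nm \<tau>}"

text \<open>Only meaningful for arguments in \<open>(T \<psi> J)\<^sup>\<bottom>\<close>, on which it is a norm.\<close>

definition h :: "('i \<Rightarrow> 'a::euclidean_space) \<Rightarrow> ('a \<Rightarrow> real) \<Rightarrow> 'i set \<Rightarrow> 'a \<Rightarrow> real" where
  "h \<psi> nm J u = Inf {t. 0 < t \<and> (1 / t) *\<^sub>R u \<in> proj ((T \<psi> J)\<^sup>\<bottom>) ` level nm 1}"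

definition C ::
  "('i \<Rightarrow> 'a::euclidean_space) \<Rightarrow> ('a \<Rightarrow> real) \<Rightarrow> ('a \<Rightarrow> real) \<Rightarrow> 'i set \<Rightarrow> real" where
  "C \<psi> nm fd J =
     measure (subspace_lborel ((T \<psi> J)\<^sup>\<bottom>)) (proj ((T \<psi> J)\<^sup>\<bottom>) ` level nm 1) *
     measure (subspace_lborel (T \<psi> J)) (T \<psi> J \<inter> level fd 1)"

text \<open>\<open>\<J> K\<close> picks exactly one representative \<open>J\<close> for every \<open>K\<close>-dimensional span \<open>T \<psi> J\<close>.\<close>

definition representatives ::
  "'i set \<Rightarrow> ('i \<Rightarrow> real^'n) \<Rightarrow> (nat \<Rightarrow> 'i set set) \<Rightarrow> bool" where
  "representatives I \<psi> \<J> \<longleftrightarrow>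
     \<J> 0 = {{}} \<and>
     (\<forall>K\<le>CARD('n).
        (\<forall>J\<in>\<J> K. J \<subseteq> I \<and> dim (T \<psi> J) = K) \<and>
        inj_on (T \<psi>) (\<J> K) \<and>
        (\<forall>J1\<subseteq>I. dim (T \<psi> J1) = K \<longrightarrow> (\<exists>J\<in>\<J> K. T \<psi> J1 = T \<psi> J)))"

definition delta_hat :: "(nat \<Rightarrow> 'i set set) \<Rightarrow> ('i set \<Rightarrow> real) \<Rightarrow> nat \<Rightarrow> real" where
  "delta_hat \<J> \<delta> K = Max (\<delta> ` \<J> K)"

definition C_bar ::
  "('i \<Rightarrow> 'a::euclidean_space) \<Rightarrow> ('a \<Rightarrow> real) \<Rightarrow> ('a \<Rightarrow> real) \<Rightarrow>
   (nat \<Rightarrow> 'i set set) \<Rightarrow> nat \<Rightarrow> real" where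
  "C_bar \<psi> nm fd \<J> K = (\<Sum>J\<in>\<J> K. C \<psi> nm fd J)"

definition H ::
  "('i \<Rightarrow> 'a::euclidean_space) \<Rightarrow> (nat \<Rightarrow> 'i set set) \<Rightarrow> nat \<Rightarrow> nat \<Rightarrow> ('i set \<times> 'i set) set" where
  "H \<psi> \<J> K k = {(J1, J2) \<in> \<J> K \<times> \<J> K. dim (T \<psi> J1 \<inter> T \<psi> J2) = k}"

definition Q ::
  "('i \<Rightarrow> 'a::euclidean_space) \<Rightarrow> ('a \<Rightarrow> real) \<Rightarrow> real \<Rightarrow> 'i set \<Rightarrow> 'i set \<Rightarrow> real" where
  "Q \<psi> fd \<delta>2 J1 J2 =
     (let W = T \<psi> J1 \<inter> T \<psi> J2
      in measure (subspace_lborel (W\<^sup>\<bottom>)) (W\<^sup>\<bottom> \<inter> level norm (2 * \<delta>2)) *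
         measure (subspace_lborel W) (W \<inter> level fd 1))"

definition delta_hat2 ::
  "('i \<Rightarrow> 'a::euclidean_space) \<Rightarrow> (nat \<Rightarrow> 'i set set) \<Rightarrow> ('i set \<Rightarrow> 'i set \<Rightarrow> real) \<Rightarrow>
   nat \<Rightarrow> nat \<Rightarrow> real" where
  "delta_hat2 \<psi> \<J> \<delta>' K k = Max (insert 0 ((\<lambda>(J1, J2). \<delta>' J1 J2) ` H \<psi> \<J> K k))"

definition Q_bar ::
  "('i \<Rightarrow> 'a::euclidean_space) \<Rightarrow> ('a \<Rightarrow> real) \<Rightarrow> real \<Rightarrow> (nat \<Rightarrow> 'i set set) \<Rightarrow>
   nat \<Rightarrow> nat \<Rightarrow> real" where
  "Q_bar \<psi> fd \<delta>2 \<J> K k = (\<Sum>(J1, J2)\<in>H \<psi> \<J> K k. Q \<psi> fd \<delta>2 J1 J2)"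

text \<open>
  Truncated subtraction makes \<open>2 * K - CARD('n)\<close> equal to \<open>max {0, 2K - N}\<close>.
  The inner maximum in \<open>Delta\<close> is over a nonempty set, since \<open>0 < K < N\<close> there.
\<close>

fun Delta ::
  "('i \<Rightarrow> real^'n) \<Rightarrow> (nat \<Rightarrow> 'i set set) \<Rightarrow> ('i set \<Rightarrow> real) \<Rightarrow> ('i set \<Rightarrow> 'i set \<Rightarrow> real) \<Rightarrow>
   nat \<Rightarrow> real" where
  "Delta \<psi> \<J> \<delta> \<delta>' 0 = delta_hat \<J> \<delta> 0"
| "Delta \<psi> \<J> \<delta> \<delta>' (Suc K') =
     (let K = Suc K' in
      if K < CARD('n)
      then Max {Delta \<psi> \<J> \<delta> \<delta>' K', delta_hat \<J> \<delta> K,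
                Max (delta_hat2 \<psi> \<J> \<delta>' K ` {2 * K - CARD('n)..K - 1})}
      else max (Delta \<psi> \<J> \<delta> \<delta>' K') (delta_hat \<J> \<delta> K))"

definition eps0 ::
  "('i \<Rightarrow> real^'n) \<Rightarrow> (real^'n \<Rightarrow> real) \<Rightarrow> real \<Rightarrow> (nat \<Rightarrow> 'i set set) \<Rightarrow>
   ('i set \<Rightarrow> 'i set \<Rightarrow> real) \<Rightarrow>
   nat \<Rightarrow> real \<Rightarrow> real \<Rightarrow> real" where
  "eps0 \<psi> fd \<delta>2 \<J> \<delta>' K \<tau> \<theta> =
     (if 0 < K \<and> K < CARD('n)
      then \<Sum>k = 2 * K - CARD('n)..K - 1.
             Q_bar \<psi> fd \<delta>2 \<J> K k * (\<tau> / \<theta>) ^ (CARD('n) - k) *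
             (1 + delta_hat2 \<psi> \<J> \<delta>' K k * (\<tau> / \<theta>)) ^ k
      else 0)"

text \<open>
  The filter on pairs of positive reals \<open>(\<tau>, \<theta>)\<close> expressing \<open>\<tau> / \<theta> \<rightarrow> 0\<close>, with no restriction
  on how \<open>\<tau>\<close> and \<open>\<theta>\<close> vary individually.
\<close>

definition ratio_to_0 :: "(real \<times> real) filter" where
  "ratio_to_0 = inf (filtercomap (\<lambda>(\<tau>, \<theta>). \<tau> / \<theta>) (at_right 0))
                    (principal {(\<tau>, \<theta>). 0 < \<tau> \<and> 0 < \<theta>})"

end

theory Submission
  imports Defs
begin

text \<open>
  A data point satisfies \<open>val \<le> K\<close> iff it lies in one of the thickened subspaces \<open>T_thick J\<close> with
  \<open>J \<in> \<J> K\<close>, so \<open>E(val) = N - (\<Sum>K<N. P(val \<le> K))\<close>, and \<open>P(val \<le> K)\<close> is the relative volume of a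
  finite union of thickened subspaces inside a level set of \<open>fd\<close>. By Fubini along
  \<open>T J\<close> and its orthogonal complement, such a thickened subspace has volume between
  \<open>C J * \<tau> ^ (N - K) * (\<theta> - \<delta> J * \<tau>) ^ K\<close> and \<open>C J * \<tau> ^ (N - K) * (\<theta> + \<delta> J * \<tau>) ^ K\<close>, since a
  displacement \<open>u\<close> orthogonal to \<open>T J\<close> changes \<open>fd\<close> by at most \<open>\<delta> J * \<tau>\<close>. The union bound and
  the Bonferroni inequality then give the two estimates; the pairwise overlaps are controlled by the
  assumption on \<open>\<delta>'\<close>. In the asymptotics only the \<open>K = N - 1\<close> term is linear in \<open>\<tau> / \<theta>\<close>.
\<close>

subsection \<open>Lebesgue measure in orthonormal frames\<close>

text \<open>The obstacle to Fubini is that \<open>subspace_lborel\<close> rests on an unspecified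
  orthonormal basis, chosen separately for every subspace. \<open>frame_lborel\<close> names the
  basis. The bases chosen for \<open>V\<close> and for its orthogonal complement together form a
  basis of the whole space, so it suffices that the full-dimensional measure is the same for every
  basis; this is \<open>frame_lborel_UNIV\<close>. All volume bounds are homogeneous of degree N in
  \<open>(\<tau>, \<theta>)\<close>: the factor with exponent N - K comes from scaling in the
  complement, the one with exponent K from scaling in the subspace. Dividing by the volume of
  \<open>level fd \<theta>\<close> leaves functions of \<open>\<tau> / \<theta>\<close> alone, which
  reduces the asymptotics to one real variable although the law of the data changes with
  \<open>\<theta>\<close>. The condition on \<open>\<theta>\<close> acts three times: it keeps
  \<open>\<theta> - \<delta> J * \<tau>\<close> nonnegative, it gives the premise under which the
  overlap bound with \<open>\<delta>'\<close> is assumed, and it forces \<open>\<theta>\<close> to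
  be positive.\<close>

definition frame_lborel :: "'a::euclidean_space set \<Rightarrow> 'a measure" where
  "frame_lborel B = distr (\<Pi>\<^sub>M b\<in>B. lborel) borel (\<lambda>x. \<Sum>b\<in>B. x b *\<^sub>R b)"

lemma measurable_frame [measurable]:
  "(\<lambda>x. \<Sum>b\<in>B. x b *\<^sub>R b) \<in> borel_measurable (\<Pi>\<^sub>M b\<in>B. (lborel :: real measure))"
  for B :: "'a::euclidean_space set"
proof -
  have "(\<lambda>x. x b) \<in> borel_measurable (\<Pi>\<^sub>M b\<in>B. (lborel :: real measure))" if "b \<in> B" for b
    using measurable_component_singleton[OF that, of "\<lambda>_. lborel :: real measure"] by simp
  then show ?thesis
    by (intro borel_measurable_sum borel_measurable_scaleR) auto
qed

lemma sets_frame_lborel [measurable_cong, simp]: "sets (frame_lborel B) = sets borel"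
  and space_frame_lborel [simp]: "space (frame_lborel B) = UNIV"
  by (auto simp: frame_lborel_def)

lemma emeasure_frame_lborel:
  "A \<in> sets borel \<Longrightarrow> emeasure (frame_lborel B) A =
     emeasure (\<Pi>\<^sub>M b\<in>B. lborel) ((\<lambda>x. \<Sum>b\<in>B. x b *\<^sub>R b) -` A \<inter> space (\<Pi>\<^sub>M b\<in>B. lborel))"
  unfolding frame_lborel_def by (subst emeasure_distr) auto

text \<open>The one-dimensional rule applies in every coordinate and each coordinate contributes a
  factor \<open>\<bar>c\<bar>\<close>. Hence the rescaled image measure \<open>R\<close> agrees with
  \<open>P\<close> on boxes, which determine a product measure.\<close>

lemma emeasure_PiM_lborel_affine:
  fixes c :: real
  assumes "finite B" "c \<noteq> 0" and A: "A \<in> sets (\<Pi>\<^sub>M b\<in>B. (lborel :: real measure))"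
  defines "P \<equiv> \<Pi>\<^sub>M b\<in>B. (lborel :: real measure)"
  shows "emeasure P A =
    ennreal (\<bar>c\<bar> ^ card B) * emeasure P ((\<lambda>x. \<lambda>b\<in>B. t b + c * x b) -` A \<inter> space P)"
proof -
  interpret product_sigma_finite "\<lambda>_::'a. (lborel :: real measure)"
    by standard
  define g where "g = (\<lambda>x. \<lambda>b\<in>B. t b + c * x b)"
  have g [measurable]: "g \<in> measurable P P"
    unfolding g_def P_def by measurable
  define R where "R = density (distr P P g) (\<lambda>_. ennreal (\<bar>c\<bar> ^ card B))"
  have "R = P"
    unfolding P_def
  proof (rule PiM_eqI)
    fix D :: "'a \<Rightarrow> real set" assume D: "\<And>i. i \<in> B \<Longrightarrow> D i \<in> sets lborel"
    have D': "Pi\<^sub>E B D \<in> sets P"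
      unfolding P_def using D assms by (intro sets_PiM_I_finite) auto
    have pre: "(\<lambda>x. t b + c * x) -` D b \<in> sets lborel" if "b \<in> B" for b
      using D[OF that] measurable_sets[of "\<lambda>x. t b + c * x" borel borel "D b"] by simp
    have "emeasure R (Pi\<^sub>E B D) = ennreal (\<bar>c\<bar> ^ card B) * emeasure (distr P P g) (Pi\<^sub>E B D)"
      unfolding R_def using D' by (subst emeasure_density_const) auto
    also have "emeasure (distr P P g) (Pi\<^sub>E B D) = emeasure P (g -` Pi\<^sub>E B D \<inter> space P)"
      using D' by (subst emeasure_distr) auto
    also have "g -` Pi\<^sub>E B D \<inter> space P = Pi\<^sub>E B (\<lambda>b. (\<lambda>x. t b + c * x) -` D b)"
      by (auto simp: g_def P_def space_PiM PiE_iff)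
    also have "emeasure P \<dots> = (\<Prod>b\<in>B. emeasure lborel ((\<lambda>x. t b + c * x) -` D b))"
      unfolding P_def using pre assms by (subst emeasure_PiM) auto
    also have "ennreal (\<bar>c\<bar> ^ card B) * \<dots> =
        (\<Prod>b\<in>B. ennreal \<bar>c\<bar> * emeasure lborel ((\<lambda>x. t b + c * x) -` D b))"
      by (simp add: prod.distrib ennreal_power)
    also have "\<dots> = (\<Prod>b\<in>B. emeasure lborel (D b))"
    proof (rule prod.cong)
      fix b assume "b \<in> B"
      then have [measurable]: "D b \<in> sets borel"
        using D by simp
      show "ennreal \<bar>c\<bar> * emeasure lborel ((\<lambda>x. t b + c * x) -` D b) = emeasure lborel (D b)"
        by (subst (2) lborel_real_affine[OF \<open>c \<noteq> 0\<close>, of "t b"])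
           (simp add: emeasure_density_const emeasure_distr)
    qed simp
    finally show "emeasure R (Pi\<^sub>E B D) = (\<Prod>b\<in>B. emeasure lborel (D b))" .
  qed (use assms in \<open>simp_all add: R_def P_def\<close>)
  then have "emeasure P A = emeasure R A"
    by simp
  also have "\<dots> = ennreal (\<bar>c\<bar> ^ card B) * emeasure P (g -` A \<inter> space P)"
    using A unfolding R_def P_def[symmetric]
    by (subst emeasure_density_const) (auto simp: emeasure_distr)
  finally show ?thesis
    by (simp add: g_def)
qed

text \<open>Used in two special cases: \<open>c = 1\<close> gives translation invariance along the
  span, and \<open>a = 0\<close> gives homogeneity of degree \<open>card B\<close>.\<close>

lemma emeasure_frame_lborel_affine:
  assumes B: "finite B" and c: "c \<noteq> 0" and a: "a \<in> span B" and A: "A \<in> sets borel"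
  shows "emeasure (frame_lborel B) A =
    ennreal (\<bar>c\<bar> ^ card B) * emeasure (frame_lborel B) {v. a + c *\<^sub>R v \<in> A}"
proof -
  obtain t where t: "a = (\<Sum>b\<in>B. t b *\<^sub>R b)"
    using a span_finite[OF B] by auto
  let ?P = "\<Pi>\<^sub>M b\<in>B. (lborel :: real measure)" and ?s = "\<lambda>x. \<Sum>b\<in>B. x b *\<^sub>R b"
  have A': "{v. a + c *\<^sub>R v \<in> A} \<in> sets borel"
    using measurable_sets[of "\<lambda>v. a + c *\<^sub>R v" borel borel A] A by (simp add: vimage_def)
  have "emeasure (frame_lborel B) A = emeasure ?P (?s -` A \<inter> space ?P)"
    using A by (rule emeasure_frame_lborel)
  also have "\<dots> = ennreal (\<bar>c\<bar> ^ card B) *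
      emeasure ?P ((\<lambda>x. \<lambda>b\<in>B. t b + c * x b) -` (?s -` A \<inter> space ?P) \<inter> space ?P)"
    using A by (intro emeasure_PiM_lborel_affine B c measurable_sets[OF measurable_frame])
  also have "(\<lambda>x. \<lambda>b\<in>B. t b + c * x b) -` (?s -` A \<inter> space ?P) \<inter> space ?P =
      ?s -` {v. a + c *\<^sub>R v \<in> A} \<inter> space ?P"
    by (auto simp: t space_PiM PiE_iff algebra_simps sum.distrib scaleR_sum_right)
  also have "emeasure ?P \<dots> = emeasure (frame_lborel B) {v. a + c *\<^sub>R v \<in> A}"
    using A' by (rule emeasure_frame_lborel[symmetric])
  finally show ?thesis .
qed

section \<open>Coordinates in an orthonormal basis; finiteness on bounded sets\<close>

lemma orthonormal_basis_inner:
  assumes "orthonormal_basis V B" "b \<in> B" "b' \<in> B"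
  shows "b \<bullet> b' = (if b = b' then 1 else 0)"
  using assms by (auto simp: orthonormal_basis_def pairwise_def orthogonal_def norm_eq_1)

lemma orthonormal_basis_independent:
  assumes "orthonormal_basis V B"
  shows "independent B" "finite B" "card B = dim V"
proof -
  show "independent B"
    using assms unfolding orthonormal_basis_def
    by (intro pairwise_orthogonal_independent) auto
  then show "finite B" "card B = dim V"
    using assms independent_imp_finite dim_eq_card_independent[of B]
    by (auto simp: orthonormal_basis_def)
qed

lemma orthonormal_basis_coord:
  assumes "orthonormal_basis V B" "b \<in> B"
  shows "(\<Sum>b'\<in>B. x b' *\<^sub>R b') \<bullet> b = x b"
proof -
  have "(\<Sum>b'\<in>B. x b' *\<^sub>R b') \<bullet> b = (\<Sum>b'\<in>B. if b' = b then x b else 0)"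
    unfolding inner_sum_left
    by (rule sum.cong) (use assms in \<open>auto simp: orthonormal_basis_inner\<close>)
  then show ?thesis
    using assms orthonormal_basis_independent(2)[OF assms(1)] by simp
qed

lemma orthonormal_basis_norm:
  assumes "orthonormal_basis V B"
  shows "norm (\<Sum>b\<in>B. x b *\<^sub>R b) = sqrt (\<Sum>b\<in>B. (x b)\<^sup>2)"
proof -
  have "(\<Sum>b\<in>B. x b *\<^sub>R b) \<bullet> (\<Sum>b\<in>B. x b *\<^sub>R b) = (\<Sum>b\<in>B. x b * ((\<Sum>b'\<in>B. x b' *\<^sub>R b') \<bullet> b))"
    by (simp add: inner_sum_right)
  also have "\<dots> = (\<Sum>b\<in>B. (x b)\<^sup>2)"
    by (rule sum.cong) (auto simp: orthonormal_basis_coord[OF assms] power2_eq_square)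
  finally show ?thesis
    by (simp add: norm_eq_sqrt_inner)
qed

text \<open>By Cauchy-Schwarz each coordinate of a point of norm at most \<open>r\<close> lies in
  \<open>{- r..r}\<close>, so the coordinates of a ball fill at most a cube, whose product measure
  is finite.\<close>

lemma emeasure_frame_lborel_bounded:
  assumes B: "orthonormal_basis V B" and "bounded A"
  shows "emeasure (frame_lborel B) A < \<infinity>"
proof -
  interpret product_sigma_finite "\<lambda>_::'a. (lborel :: real measure)"
    by standard
  note fin = orthonormal_basis_independent(2)[OF B]
  obtain r where r: "\<And>v. v \<in> A \<Longrightarrow> norm v \<le> r"
    using \<open>bounded A\<close> by (auto simp: bounded_iff)
  let ?P = "\<Pi>\<^sub>M b\<in>B. (lborel :: real measure)"
  let ?Q = "Pi\<^sub>E B (\<lambda>_. {- r..r})"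
  have "emeasure (frame_lborel B) A \<le> emeasure (frame_lborel B) (cball 0 r)"
    using r by (intro emeasure_mono) auto
  also have "\<dots> = emeasure ?P ((\<lambda>x. \<Sum>b\<in>B. x b *\<^sub>R b) -` cball 0 r \<inter> space ?P)"
    by (rule emeasure_frame_lborel) auto
  also have "\<dots> \<le> emeasure ?P ?Q"
  proof (rule emeasure_mono)
    show "(\<lambda>x. \<Sum>b\<in>B. x b *\<^sub>R b) -` cball 0 r \<inter> space ?P \<subseteq> ?Q"
    proof
      fix x assume x: "x \<in> (\<lambda>x. \<Sum>b\<in>B. x b *\<^sub>R b) -` cball 0 r \<inter> space ?P"
      have "\<bar>x b\<bar> \<le> r" if "b \<in> B" for b
      proof -
        have "\<bar>x b\<bar> \<le> norm (\<Sum>b\<in>B. x b *\<^sub>R b) * norm b"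
          using Cauchy_Schwarz_ineq2[of "\<Sum>b\<in>B. x b *\<^sub>R b" b] orthonormal_basis_coord[OF B that, of x]
          by simp
        then show ?thesis
          using x that B by (auto simp: orthonormal_basis_def)
      qed
      then show "x \<in> ?Q"
        using x by (force simp: space_PiM PiE_iff)
    qed
    show "?Q \<in> sets ?P"
      using fin by (intro sets_PiM_I_finite) auto
  qed
  also have "\<dots> = (\<Prod>b\<in>B. emeasure lborel {- r..r})"
    using fin by (intro emeasure_PiM) auto
  also have "\<dots> < \<infinity>"
    by (auto simp: emeasure_lborel_Icc_eq ennreal_power intro: ennreal_less_top)
  finally show ?thesis .
qed

lemma sigma_finite_frame_lborel:
  assumes "orthonormal_basis V B"
  shows "sigma_finite_measure (frame_lborel B)"
proof
  show "\<exists>\<A>. countable \<A> \<and> \<A> \<subseteq> sets (frame_lborel B) \<and> \<Union>\<A> = space (frame_lborel B) \<and>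
      (\<forall>a\<in>\<A>. emeasure (frame_lborel B) a \<noteq> \<infinity>)"
  proof (intro exI conjI)
    show "countable (range (\<lambda>n::nat. cball (0::'a) n))"
      by simp
    show "\<Union> (range (\<lambda>n::nat. cball (0::'a) n)) = space (frame_lborel B)"
      using real_arch_simple by auto
    show "\<forall>a\<in>range (\<lambda>n::nat. cball (0::'a) n). emeasure (frame_lborel B) a \<noteq> \<infinity>"
      using emeasure_frame_lborel_bounded[OF assms] by (auto simp: less_top)
  qed auto
qed

text \<open>Uniqueness of Haar measure: evaluate the \<open>\<nu> \<otimes> lborel\<close>-measure of
  \<open>{(x, y). x \<in> A \<and> norm (y - x) \<le> 1}\<close> in both orders.\<close>

lemma translation_invariant_eq_lborel:
  fixes \<nu> :: "'a::euclidean_space measure"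
  assumes "sigma_finite_measure \<nu>" and [measurable_cong]: "sets \<nu> = sets borel"
    and inv: "\<And>a A. A \<in> sets borel \<Longrightarrow> emeasure \<nu> {v. a + v \<in> A} = emeasure \<nu> A"
    and unit: "emeasure \<nu> (cball 0 1) = emeasure lborel (cball 0 1 :: 'a set)"
  shows "\<nu> = lborel"
proof (rule measure_eqI)
  interpret n: sigma_finite_measure \<nu> by fact
  interpret pair_sigma_finite \<nu> "lborel :: 'a measure" ..
  fix A assume "A \<in> sets \<nu>"
  then have [measurable]: "A \<in> sets borel"
    using assms(2) by simp
  have distr\<nu>: "distr \<nu> borel ((+) a) = \<nu>" for a
  proof (rule measure_eqI)
    fix X assume "X \<in> sets (distr \<nu> borel ((+) a))"
    moreover have "space \<nu> = UNIV"
      using sets_eq_imp_space_eq[OF assms(2)] by simp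
    ultimately show "emeasure (distr \<nu> borel ((+) a)) X = emeasure \<nu> X"
      using inv[of X a] by (simp add: emeasure_distr vimage_def)
  qed (simp add: assms(2))
  let ?S = "cball (0::'a) 1"
  have [measurable]: "?S \<in> sets borel"
    by (intro borel_closed closed_cball)
  let ?i = "\<lambda>X x. indicator X x :: ennreal"
  have "emeasure \<nu> A * emeasure lborel ?S = (\<integral>\<^sup>+x. ?i A x * emeasure lborel ?S \<partial>\<nu>)"
    by (simp add: nn_integral_multc assms(2))
  also have "\<dots> = (\<integral>\<^sup>+x. (\<integral>\<^sup>+y. ?i A x * ?i ?S (y - x) \<partial>lborel) \<partial>\<nu>)"
  proof (rule nn_integral_cong)
    fix x
    have "emeasure lborel ?S = (\<integral>\<^sup>+y. ?i ?S y \<partial>distr lborel borel ((+) (- x)))"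
      by (simp add: lborel_distr_plus)
    also have "\<dots> = (\<integral>\<^sup>+y. ?i ?S (- x + y) \<partial>lborel)"
      by (rule nn_integral_distr) auto
    finally show "?i A x * emeasure lborel ?S = (\<integral>\<^sup>+y. ?i A x * ?i ?S (y - x) \<partial>lborel)"
      by (simp add: nn_integral_cmult)
  qed
  also have "\<dots> = (\<integral>\<^sup>+y. (\<integral>\<^sup>+x. ?i A x * ?i ?S (y - x) \<partial>\<nu>) \<partial>lborel)"
    by (rule Fubini'[symmetric]) measurable
  \<comment> \<open>Translating x by y, which preserves \<open>\<nu>\<close>, moves y out of the
    ball condition, so that the next exchange of integrals leaves an inner integral over a translate
    of \<open>A\<close> alone.\<close>
  also have "\<dots> = (\<integral>\<^sup>+y. (\<integral>\<^sup>+x. ?i A (y + x) * ?i ?S (- x) \<partial>\<nu>) \<partial>lborel)"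
  proof (rule nn_integral_cong)
    fix y
    have "(\<integral>\<^sup>+x. ?i A x * ?i ?S (y - x) \<partial>\<nu>) =
        (\<integral>\<^sup>+x. ?i A x * ?i ?S (y - x) \<partial>distr \<nu> borel ((+) y))"
      by (simp add: distr\<nu>)
    also have "\<dots> = (\<integral>\<^sup>+x. ?i A (y + x) * ?i ?S (- x) \<partial>\<nu>)"
      by (subst nn_integral_distr) auto
    finally show "(\<integral>\<^sup>+x. ?i A x * ?i ?S (y - x) \<partial>\<nu>) = \<dots>" .
  qed
  also have "\<dots> = (\<integral>\<^sup>+x. (\<integral>\<^sup>+y. ?i A (y + x) * ?i ?S (- x) \<partial>lborel) \<partial>\<nu>)"
    by (rule Fubini') measurable
  \<comment> \<open>The ball is symmetric, so \<open>- x\<close> in it may be read as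
    \<open>x\<close>.\<close>
  also have "\<dots> = (\<integral>\<^sup>+x. emeasure lborel A * ?i ?S x \<partial>\<nu>)"
  proof (rule nn_integral_cong)
    fix x
    have "emeasure lborel A = (\<integral>\<^sup>+y. ?i A y \<partial>distr lborel borel ((+) x))"
      by (simp add: lborel_distr_plus)
    also have "\<dots> = (\<integral>\<^sup>+y. ?i A (y + x) \<partial>lborel)"
      by (subst nn_integral_distr) (auto simp: add.commute)
    finally show "(\<integral>\<^sup>+y. ?i A (y + x) * ?i ?S (- x) \<partial>lborel) = emeasure lborel A * ?i ?S x"
      by (simp add: nn_integral_multc indicator_def)
  qed
  also have "\<dots> = emeasure lborel A * emeasure lborel ?S"
    by (simp add: nn_integral_cmult assms(2) unit)
  finally have *: "emeasure \<nu> A * emeasure lborel ?S = emeasure lborel A * emeasure lborel ?S" .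
  \<comment> \<open>Positive finite volume of the ball is what permits cancelling it in
    \<open>*\<close>.\<close>
  have "emeasure lborel ?S \<noteq> 0"
    using unit_ball_vol_pos[of "real DIM('a)"] by (simp add: emeasure_cball del: unit_ball_vol_pos)
  moreover have "emeasure lborel ?S \<noteq> \<top>"
    by (simp add: emeasure_cball)
  ultimately show "emeasure \<nu> A = emeasure lborel A"
    using * by (auto simp: mult.commute[of _ "emeasure lborel ?S"] ennreal_mult_cancel_left)
qed (use assms in simp)

text \<open>Independence of the basis in full dimension. In orthonormal coordinates the unit ball is
  the set where the sum of squares is at most 1, whose product measure depends only on the number of
  coordinates; this supplies the normalisation for uniqueness of Haar measure.\<close>

lemma frame_lborel_UNIV:
  fixes B :: "'a::euclidean_space set"
  assumes B: "orthonormal_basis UNIV B"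
  shows "frame_lborel B = lborel"
proof (rule translation_invariant_eq_lborel)
  note ind = orthonormal_basis_independent[OF B]
  show "sigma_finite_measure (frame_lborel B)"
    using B by (rule sigma_finite_frame_lborel)
  show "emeasure (frame_lborel B) {v. a + v \<in> A} = emeasure (frame_lborel B) A"
    if "A \<in> sets borel" for a A
    using emeasure_frame_lborel_affine[OF ind(2), of 1 a A] that B
    by (simp add: orthonormal_basis_def)
  let ?P = "\<Pi>\<^sub>M b\<in>B. (lborel :: real measure)"
  have "B \<noteq> {}"
    using ind by auto
  have "emeasure (frame_lborel B) (cball 0 1) =
      emeasure ?P ((\<lambda>x. \<Sum>b\<in>B. x b *\<^sub>R b) -` cball 0 1 \<inter> space ?P)"
    by (rule emeasure_frame_lborel) auto
  also have "(\<lambda>x. \<Sum>b\<in>B. x b *\<^sub>R b) -` cball 0 1 = {x. sqrt (\<Sum>b\<in>B. (x b)\<^sup>2) \<le> 1}"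
    by (auto simp: orthonormal_basis_norm[OF B])
  also have "emeasure ?P (\<dots> \<inter> space ?P) = ennreal (unit_ball_vol (real DIM('a)))"
    using ind emeasure_cball_aux[OF ind(2), of 1] by simp
  finally show "emeasure (frame_lborel B) (cball 0 1) = emeasure lborel (cball 0 1 :: 'a set)"
    by (simp add: emeasure_cball)
qed simp

section \<open>Measures on subspaces and Fubini along an orthogonal splitting\<close>

lemma orthonormal_basis_exists:
  assumes "subspace V"
  shows "\<exists>B. orthonormal_basis V B"
  using orthonormal_basis_subspace[OF assms] unfolding orthonormal_basis_def by metis

lemma subspace_lborel_frame:
  assumes "subspace V"
  obtains B where "orthonormal_basis V B" "subspace_lborel V = frame_lborel B"
proof
  show "orthonormal_basis V (SOME B. orthonormal_basis V B)"
    using orthonormal_basis_exists[OF assms] by (rule someI_ex)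
qed (simp add: subspace_lborel_def frame_lborel_def Let_def)

lemma sets_subspace_lborel [measurable_cong, simp]: "sets (subspace_lborel V) = sets borel"
  and space_subspace_lborel [simp]: "space (subspace_lborel V) = UNIV"
  by (auto simp: subspace_lborel_def Let_def)

lemma emeasure_subspace_lborel_bounded:
  "subspace V \<Longrightarrow> bounded A \<Longrightarrow> emeasure (subspace_lborel V) A < \<infinity>"
  using subspace_lborel_frame emeasure_frame_lborel_bounded by metis

lemma measure_subspace_lborel_scale:
  assumes "subspace V" "0 < c" "A \<in> sets borel"
  shows "measure (subspace_lborel V) A = c ^ dim V * measure (subspace_lborel V) {v. c *\<^sub>R v \<in> A}"
proof -
  obtain B where B: "orthonormal_basis V B" "subspace_lborel V = frame_lborel B"
    using subspace_lborel_frame[OF assms(1)] .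
  show ?thesis
    using emeasure_frame_lborel_affine[of B c 0 A] assms orthonormal_basis_independent[OF B(1)]
    by (simp add: B(2) measure_def span_zero enn2real_mult)
qed

text \<open>Since \<open>subspace_lborel V\<close> is a measure on the ambient space, this is what
  later allows integration points to be taken in \<open>V\<close>.\<close>

lemma AE_subspace_lborel:
  assumes "subspace V"
  shows "AE v in subspace_lborel V. v \<in> V"
proof -
  obtain B where B: "orthonormal_basis V B" "subspace_lborel V = frame_lborel B"
    using subspace_lborel_frame[OF assms] .
  have "(\<Sum>b\<in>B. x b *\<^sub>R b) \<in> V" for x
    using B(1) span_base[of _ B] unfolding orthonormal_basis_def
    by (auto simp del: span_base intro!: span_sum span_scale)
  moreover have "{v. v \<in> V} \<in> sets borel"
    using closed_subspace[OF assms] by simp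
  ultimately show ?thesis
    unfolding B(2) frame_lborel_def by (subst AE_distr_iff) auto
qed

lemma orthogonal_comp_inner: "v \<in> V \<Longrightarrow> u \<in> V\<^sup>\<bottom> \<Longrightarrow> v \<bullet> u = 0"
  by (auto simp: orthogonal_comp_def orthogonal_def)

lemma orthonormal_basis_Un:
  fixes V :: "'a::euclidean_space set"
  assumes "subspace V" and B: "orthonormal_basis V B" and B': "orthonormal_basis (V\<^sup>\<bottom>) B'"
  shows "B \<inter> B' = {}" "orthonormal_basis UNIV (B \<union> B')"
proof -
  have sub: "B \<subseteq> V" "B' \<subseteq> V\<^sup>\<bottom>"
    using B B' span_superset[of B] span_superset[of B'] unfolding orthonormal_basis_def by blast+
  then have 0: "b \<bullet> b' = 0" "b' \<bullet> b = 0" if "b \<in> B" "b' \<in> B'" for b b'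
    using that orthogonal_comp_inner[of b V b'] by (auto simp: inner_commute)
  show "B \<inter> B' = {}"
  proof (rule ccontr)
    assume "B \<inter> B' \<noteq> {}"
    then obtain b where "b \<in> B" "b \<in> B'"
      by auto
    then show False
      using 0[of b b] B by (auto simp: orthonormal_basis_def)
  qed
  have "V + V\<^sup>\<bottom> \<subseteq> span (B \<union> B')"
  proof
    fix x assume "x \<in> V + V\<^sup>\<bottom>"
    then obtain v u where "x = v + u" "v \<in> span B" "u \<in> span B'"
      using B B' by (auto simp: orthonormal_basis_def set_plus_def)
    then show "x \<in> span (B \<union> B')"
      using span_mono[of B "B \<union> B'"] span_mono[of B' "B \<union> B'"] by (auto intro: span_add)
  qed
  then have "span (B \<union> B') = UNIV"
    using subspace_sum_orthogonal_comp[OF assms(1)] by auto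
  then show "orthonormal_basis UNIV (B \<union> B')"
    using B B' 0 by (auto simp: orthonormal_basis_def pairwise_def orthogonal_def)
qed

lemma dim_orthogonal_comp:
  fixes V :: "'a::euclidean_space set"
  assumes "subspace V"
  shows "dim V + dim (V\<^sup>\<bottom>) = DIM('a)"
proof -
  obtain B where B: "orthonormal_basis V B"
    using orthonormal_basis_exists[OF assms] by blast
  obtain B' where B': "orthonormal_basis (V\<^sup>\<bottom>) B'"
    using orthonormal_basis_exists[OF subspace_orthogonal_comp] by blast
  note Un = orthonormal_basis_Un[OF assms B B']
  have "card (B \<union> B') = dim V + dim (V\<^sup>\<bottom>)"
    using Un(1) orthonormal_basis_independent[OF B] orthonormal_basis_independent[OF B']
    by (simp add: card_Un_disjoint)
  then show ?thesis
    using orthonormal_basis_independent(3)[OF Un(2)] by simp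
qed

text \<open>The two chosen bases unite to an orthonormal basis of the whole space, where the frame
  measure is \<open>lborel\<close>; Fubini for product measures then separates the two blocks of
  coordinates.\<close>

lemma emeasure_lborel_subspace:
  fixes V :: "'a::euclidean_space set"
  assumes V: "subspace V" and [measurable]: "A \<in> sets borel"
  shows "emeasure lborel A =
    (\<integral>\<^sup>+u. emeasure (subspace_lborel V) {v. v + u \<in> A} \<partial>subspace_lborel (V\<^sup>\<bottom>))"
proof -
  interpret product_sigma_finite "\<lambda>_::'a. (lborel :: real measure)"
    by standard
  obtain B where B: "orthonormal_basis V B" "subspace_lborel V = frame_lborel B"
    using subspace_lborel_frame[OF V] .
  obtain B' where B': "orthonormal_basis (V\<^sup>\<bottom>) B'" "subspace_lborel (V\<^sup>\<bottom>) = frame_lborel B'"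
    using subspace_lborel_frame[OF subspace_orthogonal_comp] .
  note fin = orthonormal_basis_independent(2)[OF B(1)] orthonormal_basis_independent(2)[OF B'(1)]
  note Un = orthonormal_basis_Un[OF V B(1) B'(1)]
  interpret B: sigma_finite_measure "frame_lborel B"
    using sigma_finite_frame_lborel[OF B(1)] .
  let ?P = "\<lambda>D. \<Pi>\<^sub>M b\<in>D. (lborel :: real measure)" and ?s = "\<lambda>D x. \<Sum>b\<in>D. x b *\<^sub>R b"
  have slice [measurable]: "{v. v + u \<in> A} \<in> sets borel" for u
    using measurable_sets[of "\<lambda>v. v + u" borel borel A] by (simp add: vimage_def)
  \<comment> \<open>\<open>emeasure_fold_integral\<close> integrates the first block outermost, so
    \<open>B'\<close> has to come first for the slices to lie along \<open>V\<close>.\<close>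
  have "emeasure lborel A = emeasure (frame_lborel (B' \<union> B)) A"
    using frame_lborel_UNIV[OF Un(2)] by (simp add: Un_commute)
  also have "\<dots> = emeasure (?P (B' \<union> B)) (?s (B' \<union> B) -` A \<inter> space (?P (B' \<union> B)))"
    by (rule emeasure_frame_lborel) simp
  also have "\<dots> = (\<integral>\<^sup>+x. emeasure (?P B)
      ((\<lambda>y. merge B' B (x, y)) -` (?s (B' \<union> B) -` A \<inter> space (?P (B' \<union> B))) \<inter> space (?P B)) \<partial>?P B')"
    by (rule emeasure_fold_integral) (use fin Un(1) in auto)
  also have "\<dots> = (\<integral>\<^sup>+x. emeasure (frame_lborel B) {v. v + ?s B' x \<in> A} \<partial>?P B')"
  proof (rule nn_integral_cong)
    fix x assume x: "x \<in> space (?P B')"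
    have s: "?s (B' \<union> B) (merge B' B (x, y)) = ?s B y + ?s B' x" for y
    proof -
      have "?s (B' \<union> B) (merge B' B (x, y)) =
          ?s B' (merge B' B (x, y)) + ?s B (merge B' B (x, y))"
        using fin Un(1) by (intro sum.union_disjoint) auto
      moreover have "?s B' (merge B' B (x, y)) = ?s B' x"
        by (rule sum.cong) (auto simp: merge_def)
      moreover have "?s B (merge B' B (x, y)) = ?s B y"
        using Un(1) by (intro sum.cong) (auto simp: merge_def)
      ultimately show ?thesis
        by simp
    qed
    have "(\<lambda>y. merge B' B (x, y)) -` (?s (B' \<union> B) -` A \<inter> space (?P (B' \<union> B))) \<inter> space (?P B)
        = ?s B -` {v. v + ?s B' x \<in> A} \<inter> space (?P B)"
    proof -
      have "merge B' B (x, y) \<in> space (?P (B' \<union> B))" if "y \<in> space (?P B)" for y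
        using x that by (auto simp: space_PiM PiE_iff merge_def extensional_def)
      then show ?thesis
        by (auto simp: s)
    qed
    then show "emeasure (?P B)
      ((\<lambda>y. merge B' B (x, y)) -` (?s (B' \<union> B) -` A \<inter> space (?P (B' \<union> B))) \<inter> space (?P B)) =
      emeasure (frame_lborel B) {v. v + ?s B' x \<in> A}"
      by (simp add: emeasure_frame_lborel)
  qed
  also have "\<dots> = (\<integral>\<^sup>+u. emeasure (frame_lborel B) {v. v + u \<in> A} \<partial>frame_lborel B')"
  proof -
    \<comment> \<open>Written as an inner integral, the slice measure is measurable in
      \<open>u\<close> by sigma-finiteness of the frame measure; the change of variables below asks
      for this.\<close>
    have eq: "emeasure (frame_lborel B) {v. v + u \<in> A} = (\<integral>\<^sup>+v. indicator A (v + u) \<partial>frame_lborel B)" for u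
    proof -
      have "(\<integral>\<^sup>+v. indicator A (v + u) \<partial>frame_lborel B) =
          (\<integral>\<^sup>+v. indicator {v. v + u \<in> A} v \<partial>frame_lborel B)"
        by (rule nn_integral_cong) (simp split: split_indicator)
      also have "\<dots> = emeasure (frame_lborel B) {v. v + u \<in> A}"
        by (rule nn_integral_indicator) (simp add: slice)
      finally show ?thesis ..
    qed
    have "(\<lambda>u. emeasure (frame_lborel B) {v. v + u \<in> A}) \<in> borel_measurable borel"
      unfolding eq by measurable
    then show ?thesis
      unfolding frame_lborel_def[of B'] by (subst nn_integral_distr) auto
  qed
  finally show ?thesis
    by (simp add: B B')
qed

section \<open>Orthogonal decomposition and projection\<close>

lemma orthogonal_decomposition:
  fixes V :: "'a::euclidean_space set"
  assumes "subspace V"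
  obtains v u where "x = v + u" "v \<in> V" "u \<in> V\<^sup>\<bottom>"
  using subspace_sum_orthogonal_comp[OF assms] by (metis UNIV_I set_plus_elim)

lemma orthogonal_decomposition_unique:
  fixes V :: "'a::euclidean_space set"
  assumes V: "subspace V" and "v \<in> V" "v' \<in> V" "u \<in> V\<^sup>\<bottom>" "u' \<in> V\<^sup>\<bottom>" "v + u = v' + u'"
  shows "v = v'" "u = u'"
proof -
  have "v - v' = u' - u"
    using assms(6) by (simp add: algebra_simps)
  moreover have "v - v' \<in> V" "u' - u \<in> V\<^sup>\<bottom>"
    using assms subspace_orthogonal_comp by (auto intro: subspace_diff)
  ultimately have "v - v' = 0"
    using orthogonal_comp_inner[of "v - v'" V "u' - u"] by simp
  then show "v = v'" "u = u'"
    using assms(6) by auto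
qed

lemma proj_orthogonal_comp_add:
  fixes V :: "'a::euclidean_space set"
  assumes V: "subspace V" and "v \<in> V" "u \<in> V\<^sup>\<bottom>"
  shows "proj (V\<^sup>\<bottom>) (v + u) = u"
  \<comment> \<open>The complement of the complement is \<open>V\<close> again, so the residual in
    the definition of \<open>proj\<close> has to lie in \<open>V\<close>.\<close>
  unfolding proj_def orthogonal_comp_self[OF V]
proof (rule the_equality)
  fix p assume "p \<in> V\<^sup>\<bottom> \<and> v + u - p \<in> V"
  then show "p = u"
    using orthogonal_decomposition_unique(2)[OF V, of "v + u - p" v p u] assms by simp
qed (use assms in simp)

lemma linear_proj_orthogonal_comp:
  fixes V :: "'a::euclidean_space set"
  assumes V: "subspace V"
  shows "linear (proj (V\<^sup>\<bottom>))"
proof (rule linearI)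
  note W = subspace_orthogonal_comp[of V]
  fix x y c
  obtain v u where x: "x = v + u" "v \<in> V" "u \<in> V\<^sup>\<bottom>"
    using orthogonal_decomposition[OF V] .
  obtain v' u' where y: "y = v' + u'" "v' \<in> V" "u' \<in> V\<^sup>\<bottom>"
    using orthogonal_decomposition[OF V] .
  have "x + y = (v + v') + (u + u')" "c *\<^sub>R x = c *\<^sub>R v + c *\<^sub>R u"
    by (auto simp: x y algebra_simps)
  then show "proj (V\<^sup>\<bottom>) (x + y) = proj (V\<^sup>\<bottom>) x + proj (V\<^sup>\<bottom>) y"
    "proj (V\<^sup>\<bottom>) (c *\<^sub>R x) = c *\<^sub>R proj (V\<^sup>\<bottom>) x"
    using x y V W
    by (simp_all only: proj_orthogonal_comp_add subspace_add subspace_scale)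
qed

text \<open>Trades the projection for the existence of a point of the level set on the fibre over
  \<open>u\<close>; all later arguments about shadows of level sets work with such fibres.\<close>

lemma proj_image_level:
  fixes V :: "'a::euclidean_space set"
  assumes V: "subspace V"
  shows "proj (V\<^sup>\<bottom>) ` level f t = {u \<in> V\<^sup>\<bottom>. \<exists>v\<in>V. f (v + u) \<le> t}"
proof (intro equalityI subsetI)
  fix p assume "p \<in> proj (V\<^sup>\<bottom>) ` level f t"
  then obtain x where x: "p = proj (V\<^sup>\<bottom>) x" "f x \<le> t"
    by (auto simp: level_def)
  obtain v u where "x = v + u" "v \<in> V" "u \<in> V\<^sup>\<bottom>"
    using orthogonal_decomposition[OF V] .
  then show "p \<in> {u \<in> V\<^sup>\<bottom>. \<exists>v\<in>V. f (v + u) \<le> t}"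
    using x by (auto simp: proj_orthogonal_comp_add[OF V])
next
  fix p assume "p \<in> {u \<in> V\<^sup>\<bottom>. \<exists>v\<in>V. f (v + u) \<le> t}"
  then obtain v where v: "p \<in> V\<^sup>\<bottom>" "v \<in> V" "f (v + p) \<le> t"
    by auto
  then show "p \<in> proj (V\<^sup>\<bottom>) ` level f t"
    using proj_orthogonal_comp_add[OF V v(2,1)] by (force simp: level_def)
qed

subsection \<open>Norms\<close>

context
  fixes f :: "'a::euclidean_space \<Rightarrow> real"
  assumes f: "is_norm f"
begin

lemma is_norm_nonneg: "0 \<le> f x"
  and is_norm_eq_0: "f x = 0 \<longleftrightarrow> x = 0"
  and is_norm_scale: "f (a *\<^sub>R x) = \<bar>a\<bar> * f x"
  and is_norm_add: "f (x + y) \<le> f x + f y"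
  using f by (auto simp: is_norm_def)

lemma is_norm_minus: "f (- x) = f x"
  using is_norm_scale[of "-1" x] by simp

lemma is_norm_minus_commute: "f (x - y) = f (y - x)"
  using is_norm_minus[of "x - y"] by simp

text \<open>Expansion in \<open>Basis\<close> bounds \<open>f\<close> by a multiple of
  \<open>norm\<close>; applied to differences, the triangle inequality makes \<open>f\<close>
  Lipschitz.\<close>

lemma is_norm_continuous: "continuous_on UNIV f"
proof -
  have "f (\<Sum>b\<in>S. (x \<bullet> b) *\<^sub>R b) \<le> (\<Sum>b\<in>S. f b) * norm x" if "finite S" "S \<subseteq> Basis" for x S
    using that
  proof (induction S rule: finite_induct)
    case empty
    then show ?case using is_norm_eq_0[of 0] by simp
  next
    case (insert b S)
    have "f (\<Sum>b\<in>insert b S. (x \<bullet> b) *\<^sub>R b) \<le> f ((x \<bullet> b) *\<^sub>R b) + f (\<Sum>b\<in>S. (x \<bullet> b) *\<^sub>R b)"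
      using insert is_norm_add by simp
    moreover have "f ((x \<bullet> b) *\<^sub>R b) \<le> norm x * f b"
      unfolding is_norm_scale using insert Basis_le_norm[of b x]
      by (intro mult_right_mono is_norm_nonneg) auto
    ultimately show ?case
      using insert by (simp add: algebra_simps)
  qed
  from this[of Basis] have le: "f x \<le> (\<Sum>b\<in>Basis. f b) * norm x" for x
    by (simp add: euclidean_representation)
  let ?L = "\<Sum>b\<in>Basis. f b"
  have "?L-lipschitz_on UNIV f"
  proof (rule lipschitz_onI)
    show "dist (f x) (f y) \<le> ?L * dist x y" for x y
      using is_norm_add[of "x - y" y] is_norm_add[of "y - x" x] is_norm_minus_commute[of x y]
        le[of "x - y"] by (simp add: dist_norm)
  qed (simp add: is_norm_nonneg sum_nonneg)
  then show ?thesis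
    by (rule lipschitz_on_continuous_on)
qed

text \<open>The constant is the minimum of \<open>f\<close> on the Euclidean unit sphere, attained
  by compactness and positive because \<open>f\<close> vanishes only at 0.\<close>

lemma is_norm_lower_bound:
  obtains c where "0 < c" "\<And>x. c * norm x \<le> f x"
proof -
  obtain e :: 'a where e: "e \<in> Basis"
    using nonempty_Basis by blast
  have "\<exists>x\<in>sphere 0 1. \<forall>y\<in>sphere 0 1. f x \<le> f y"
  proof (rule continuous_attains_inf)
    show "continuous_on (sphere 0 1) f"
      using is_norm_continuous continuous_on_subset by blast
    have "e \<in> sphere 0 1"
      using e by simp
    then show "sphere (0::'a) 1 \<noteq> {}"
      by auto
  qed (rule compact_sphere)
  then obtain x where x: "norm x = 1" "\<And>y. norm y = 1 \<Longrightarrow> f x \<le> f y"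
    by auto
  show thesis
  proof
    show "0 < f x"
      using is_norm_nonneg[of x] is_norm_eq_0[of x] x(1) by fastforce
    show "f x * norm y \<le> f y" for y
    proof (cases "y = 0")
      case False
      then have "f x \<le> f (inverse (norm y) *\<^sub>R y)"
        by (intro x) simp
      then show ?thesis
        using False by (simp add: is_norm_scale field_simps)
    qed (simp add: is_norm_nonneg)
  qed
qed

lemma compact_level: "compact (level f t)"
proof -
  obtain c where c: "0 < c" "\<And>x. c * norm x \<le> f x"
    using is_norm_lower_bound by blast
  have "norm x \<le> t / c" if "x \<in> level f t" for x
    using c(2)[of x] that c(1) by (simp add: level_def field_simps)
  then have "bounded (level f t)"
    by (auto simp: bounded_iff)
  moreover have "closed (level f t)"
    unfolding level_def using is_norm_continuous by (intro closed_Collect_le) auto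
  ultimately show ?thesis
    by (simp add: compact_eq_bounded_closed)
qed

lemma level_scale: "0 < s \<Longrightarrow> s *\<^sub>R x \<in> level f t \<longleftrightarrow> x \<in> level f (t / s)"
  by (simp add: level_def is_norm_scale field_simps)

lemma measure_level_pos: "0 < t \<Longrightarrow> 0 < measure lborel (level f t)"
proof -
  assume "0 < t"
  have "open {x. f x < t}"
    using is_norm_continuous by (intro open_Collect_less) auto
  moreover have "f 0 = 0"
    using is_norm_eq_0 by simp
  ultimately obtain e where e: "0 < e" "ball 0 e \<subseteq> {x. f x < t}"
    using \<open>0 < t\<close> open_contains_ball[of "{x. f x < t}"] by force
  have "0 < measure lborel (ball (0::'a) e)"
    using e(1) content_ball_pos by blast
  also have "\<dots> \<le> measure lborel (level f t)"
    using e(2) emeasure_bounded_finite[OF compact_imp_bounded[OF compact_level[of t]]]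
      borel_compact[OF compact_level[of t]]
    by (intro measure_mono_fmeasurable) (auto simp: level_def fmeasurable_def)
  finally show ?thesis .
qed

lemma measure_level_scale:
  assumes "0 < s"
  shows "measure lborel (level f s) = s ^ DIM('a) * measure lborel (level f 1)"
proof -
  have "subspace_lborel (UNIV :: 'a set) = lborel"
    using subspace_lborel_frame[of "UNIV :: 'a set"] frame_lborel_UNIV by (metis subspace_UNIV)
  then show ?thesis
    using measure_subspace_lborel_scale[of UNIV s "level f s"] assms
      borel_compact[OF compact_level[of s]] by (simp add: level_scale)
qed

end

subsection \<open>Thickened subspaces\<close>

text \<open>\<open>T_thick\<close> with an arbitrary subspace in place of a span, so that the volume
  estimate is independent of the dictionary.\<close>

definition thick :: "'a::euclidean_space set \<Rightarrow> ('a \<Rightarrow> real) \<Rightarrow> real \<Rightarrow> 'a set" where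
  "thick V f t = {v + u | v u. v \<in> V \<and> u \<in> proj (V\<^sup>\<bottom>) ` level f t}"

text \<open>Links the geometric thickening to the constraint of the approximation problem: the
  component along \<open>V\<close> of a level-set point can be absorbed into the
  approximant.\<close>

lemma mem_thick_iff:
  fixes V :: "'a::euclidean_space set"
  assumes V: "subspace V" and "is_norm f"
  shows "x \<in> thick V f t \<longleftrightarrow> (\<exists>v\<in>V. f (v - x) \<le> t)"
proof
  assume "x \<in> thick V f t"
  then obtain v u w where vu: "x = v + u" "v \<in> V" "w \<in> V" "f (w + u) \<le> t"
    by (auto simp: thick_def proj_image_level[OF V])
  then show "\<exists>v\<in>V. f (v - x) \<le> t"
    using is_norm_minus[OF assms(2), of "w + u"] subspace_diff[OF V vu(2,3)]
    by (intro bexI[of _ "v - w"]) auto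
next
  assume "\<exists>v\<in>V. f (v - x) \<le> t"
  then obtain w where w: "w \<in> V" "f (x - w) \<le> t"
    using is_norm_minus_commute[OF assms(2)] by metis
  obtain v u where x: "x = v + u" "v \<in> V" "u \<in> V\<^sup>\<bottom>"
    using orthogonal_decomposition[OF V] .
  have "f ((v - w) + u) \<le> t"
    using w(2) x(1) by (simp add: algebra_simps)
  moreover have "v - w \<in> V"
    using x(2) w(1) V by (simp add: subspace_diff)
  ultimately show "x \<in> thick V f t"
    using x by (auto simp: thick_def proj_image_level[OF V])
qed

lemma compact_proj_level:
  assumes "subspace V" "is_norm f"
  shows "compact (proj (V\<^sup>\<bottom>) ` level f t)"
  using assms
  by (intro compact_continuous_image linear_continuous_on linear_linear[THEN iffD2]
      linear_proj_orthogonal_comp compact_level)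

lemma closed_thick:
  assumes "subspace V" "is_norm f"
  shows "closed (thick V f t)"
proof -
  have "thick V f t = (\<Union>x\<in>V. \<Union>y\<in>proj (V\<^sup>\<bottom>) ` level f t. {x + y})"
    by (auto simp: thick_def)
  then show ?thesis
    using closed_compact_sums[OF closed_subspace compact_proj_level] assms by metis
qed

text \<open>Over a point \<open>u\<close> of the shadow \<open>?P \<tau>\<close> the slice of
  \<open>A\<close> lies between the slices \<open>V \<inter> level fd s\<close> with
  \<open>s = \<theta> - \<delta> * \<tau>\<close> and
  \<open>s = \<theta> + \<delta> * \<tau>\<close>; over other points it is null. Both bounds thus
  become a product of the volume of the shadow and the volume of a slice, and each factor is
  homogeneous.\<close>

lemma measure_thick_bounds:
  fixes V :: "'a::euclidean_space set" and \<delta> :: real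
  assumes V: "subspace V" and nm: "is_norm nm" and fd: "is_norm fd"
    and \<tau>: "0 < \<tau>" and \<theta>: "0 < \<theta>" "\<delta> * \<tau> \<le> \<theta>" and "0 \<le> \<delta>"
    and dom: "\<And>u. u \<in> proj (V\<^sup>\<bottom>) ` level nm \<tau> \<Longrightarrow> fd u \<le> \<delta> * \<tau>"
  defines "c \<equiv> measure (subspace_lborel (V\<^sup>\<bottom>)) (proj (V\<^sup>\<bottom>) ` level nm 1) *
      measure (subspace_lborel V) (V \<inter> level fd 1)"
    and "A \<equiv> thick V nm \<tau> \<inter> level fd \<theta>"
  shows "measure lborel A \<le> c * \<tau> ^ (DIM('a) - dim V) * (\<theta> + \<delta> * \<tau>) ^ dim V" (is ?upper)
    and "c * \<tau> ^ (DIM('a) - dim V) * (\<theta> - \<delta> * \<tau>) ^ dim V \<le> measure lborel A" (is ?lower)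
proof -
  let ?W = "V\<^sup>\<bottom>"
  let ?P = "\<lambda>t. proj ?W ` level nm t" and ?m = "subspace_lborel V" and ?n = "subspace_lborel ?W"
  note W = subspace_orthogonal_comp[of V]
  have dimW: "dim ?W = DIM('a) - dim V"
    using dim_orthogonal_comp[OF V] by simp
  have slice_sets: "V \<inter> level fd s \<in> sets borel" for s
    using closed_subspace[OF V] compact_level[OF fd] by (auto intro: borel_closed compact_imp_closed)
  have slice_bdd: "bounded (V \<inter> level fd s)" for s
    using compact_imp_bounded[OF compact_level[OF fd]] by (rule bounded_subset) auto
  have P_sets [measurable]: "?P t \<in> sets borel" for t
    by (rule borel_compact[OF compact_proj_level[OF V nm]])
  have P_bdd: "bounded (?P t)" for t
    by (rule compact_imp_bounded[OF compact_proj_level[OF V nm]])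
  have A: "A \<in> sets borel" "bounded A" unfolding A_def
    using closed_thick[OF V nm] compact_level[OF fd, of \<theta>]
    by (auto intro: borel_closed compact_imp_closed compact_imp_bounded bounded_subset)
  have eA: "emeasure lborel A = ennreal (measure lborel A)"
    using emeasure_bounded_finite[OF A(2)] by (intro emeasure_eq_ennreal_measure) (simp add: less_top)
  have em: "emeasure ?m X = ennreal (measure ?m X)" if "bounded X" for X
    using emeasure_subspace_lborel_bounded[OF V that]
    by (intro emeasure_eq_ennreal_measure) (simp add: less_top)
  have en: "emeasure ?n X = ennreal (measure ?n X)" if "bounded X" for X
    using emeasure_subspace_lborel_bounded[OF W that]
    by (intro emeasure_eq_ennreal_measure) (simp add: less_top)
  have P_scale: "measure ?n (?P \<tau>) = \<tau> ^ (DIM('a) - dim V) * measure ?n (?P 1)"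
  proof -
    have "{u. \<tau> *\<^sub>R u \<in> ?P \<tau>} = ?P 1"
    proof -
      have "\<tau> *\<^sub>R u \<in> ?P \<tau> \<longleftrightarrow> u \<in> ?P 1" for u
      proof
        assume "\<tau> *\<^sub>R u \<in> ?P \<tau>"
        then obtain x where x: "\<tau> *\<^sub>R u = proj ?W x" "x \<in> level nm \<tau>"
          by auto
        have "u = (1 / \<tau>) *\<^sub>R (\<tau> *\<^sub>R u)"
          using \<tau> by simp
        also have "\<dots> = proj ?W ((1 / \<tau>) *\<^sub>R x)"
          by (simp only: x(1) linear_cmul[OF linear_proj_orthogonal_comp[OF V]])
        finally show "u \<in> ?P 1"
          using x(2) \<tau> level_scale[OF nm, of "1 / \<tau>" x 1] by auto
      next
        assume "u \<in> ?P 1"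
        then obtain x where x: "u = proj ?W x" "x \<in> level nm 1"
          by auto
        have "\<tau> *\<^sub>R u = proj ?W (\<tau> *\<^sub>R x)"
          by (simp only: x(1) linear_cmul[OF linear_proj_orthogonal_comp[OF V]])
        then show "\<tau> *\<^sub>R u \<in> ?P \<tau>"
          using x(2) \<tau> level_scale[OF nm, of \<tau> x \<tau>] by auto
      qed
      then show ?thesis by blast
    qed
    then show ?thesis
      using measure_subspace_lborel_scale[OF W \<tau> P_sets[of \<tau>]] dimW by simp
  qed
  have slice_scale: "measure ?m (V \<inter> level fd s) = s ^ dim V * measure ?m (V \<inter> level fd 1)"
    if "0 < s" for s
  proof -
    have "s *\<^sub>R v \<in> V \<longleftrightarrow> v \<in> V" for v
      using subspace_scale[OF V, of v s] subspace_scale[OF V, of "s *\<^sub>R v" "1 / s"] that by auto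
    then have "{v. s *\<^sub>R v \<in> V \<inter> level fd s} = V \<inter> level fd 1"
      using that by (auto simp: level_scale[OF fd])
    then show ?thesis
      using measure_subspace_lborel_scale[OF V that slice_sets[of s]] by simp
  qed
  have slice: "{v. v + u \<in> A} \<in> sets borel" for u
    using measurable_sets[of "\<lambda>v. v + u" borel borel A] A by (simp add: vimage_def)
  \<comment> \<open>Uniqueness of the decomposition: moving along \<open>V\<close> does not change
    the component in the complement, so membership in the thickening depends on \<open>u\<close>
    only.\<close>
  have A_iff: "v + u \<in> A \<longleftrightarrow> u \<in> ?P \<tau> \<and> v + u \<in> level fd \<theta>" if "v \<in> V" "u \<in> ?W" for u v
  proof -
    have "u \<in> ?P \<tau>" if th: "v + u \<in> thick V nm \<tau>"
    proof -
      obtain v' u' where *: "v + u = v' + u'" "v' \<in> V" "u' \<in> ?P \<tau>"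
        using th unfolding thick_def by blast
      then have "u' \<in> ?W"
        by (auto simp: proj_image_level[OF V])
      then show ?thesis
        using orthogonal_decomposition_unique(2)[OF V] * \<open>v \<in> V\<close> \<open>u \<in> ?W\<close> by metis
    qed
    then show ?thesis
      using that by (auto simp: A_def thick_def)
  qed
  have AE_W: "AE u in ?n. u \<in> ?W"
    by (rule AE_subspace_lborel[OF W])
  have AE_V: "AE v in ?m. v \<in> V"
    by (rule AE_subspace_lborel[OF V])
  have up: "emeasure ?m {v. v + u \<in> A} \<le>
      indicator (?P \<tau>) u * emeasure ?m (V \<inter> level fd (\<theta> + \<delta> * \<tau>))" if u: "u \<in> ?W" for u
  proof (cases "u \<in> ?P \<tau>")
    case True
    have "v \<in> level fd (\<theta> + \<delta> * \<tau>)" if "v + u \<in> A" for v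
    proof -
      have "fd v \<le> fd (v + u) + fd (- u)"
        using is_norm_add[OF fd, of "v + u" "- u"] by simp
      then show ?thesis
        using dom[OF True] that is_norm_minus[OF fd, of u] by (simp add: A_def level_def)
    qed
    then have "AE v in ?m. v \<in> {v. v + u \<in> A} \<longrightarrow> v \<in> V \<inter> level fd (\<theta> + \<delta> * \<tau>)"
      using AE_V by auto
    then have "emeasure ?m {v. v + u \<in> A} \<le> emeasure ?m (V \<inter> level fd (\<theta> + \<delta> * \<tau>))"
      using slice_sets by (intro emeasure_mono_AE) auto
    then show ?thesis
      using True by simp
  next
    case False
    \<comment> \<open>The slice may contain points off \<open>V\<close>, but \<open>?m\<close> gives
      those no mass.\<close>
    then have "AE v in ?m. v \<notin> {v. v + u \<in> A}"
      using AE_V A_iff u by auto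
    then have "emeasure ?m {v. v + u \<in> A} = 0"
      using slice by (subst (asm) AE_iff_measurable[OF _ refl]) auto
    then show ?thesis
      by simp
  qed
  have low: "indicator (?P \<tau>) u * emeasure ?m (V \<inter> level fd (\<theta> - \<delta> * \<tau>)) \<le>
      emeasure ?m {v. v + u \<in> A}" if u: "u \<in> ?W" for u
  proof (cases "u \<in> ?P \<tau>")
    case True
    have "v + u \<in> A" if "v \<in> V \<inter> level fd (\<theta> - \<delta> * \<tau>)" for v
      using is_norm_add[OF fd, of v u] dom[OF True] that True u
      by (subst A_iff) (auto simp: level_def)
    then show ?thesis
      using True slice by (auto intro!: emeasure_mono)
  qed simp
  have "ennreal (measure lborel A) = (\<integral>\<^sup>+u. emeasure ?m {v. v + u \<in> A} \<partial>?n)"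
    using emeasure_lborel_subspace[OF V A(1)] eA by simp
  also have "\<dots> \<le> (\<integral>\<^sup>+u. indicator (?P \<tau>) u * emeasure ?m (V \<inter> level fd (\<theta> + \<delta> * \<tau>)) \<partial>?n)"
    using AE_W up by (intro nn_integral_mono_AE) auto
  also have "\<dots> = emeasure ?n (?P \<tau>) * emeasure ?m (V \<inter> level fd (\<theta> + \<delta> * \<tau>))"
    by (simp add: nn_integral_multc)
  also have "\<dots> = ennreal (measure ?n (?P \<tau>) * measure ?m (V \<inter> level fd (\<theta> + \<delta> * \<tau>)))"
    by (simp add: em[OF slice_bdd] en[OF P_bdd] ennreal_mult)
  finally have "measure lborel A \<le> measure ?n (?P \<tau>) * measure ?m (V \<inter> level fd (\<theta> + \<delta> * \<tau>))"
    by (simp add: ennreal_le_iff)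
  moreover have "0 < \<theta> + \<delta> * \<tau>"
    using \<theta> \<tau> \<open>0 \<le> \<delta>\<close> by (simp add: add_pos_nonneg)
  ultimately show ?upper
    by (simp add: P_scale slice_scale[of "\<theta> + \<delta> * \<tau>"] c_def mult_ac)
  have "ennreal (measure ?n (?P \<tau>) * measure ?m (V \<inter> level fd (\<theta> - \<delta> * \<tau>))) =
      emeasure ?n (?P \<tau>) * emeasure ?m (V \<inter> level fd (\<theta> - \<delta> * \<tau>))"
    by (simp add: em[OF slice_bdd] en[OF P_bdd] ennreal_mult)
  also have "\<dots> = (\<integral>\<^sup>+u. indicator (?P \<tau>) u * emeasure ?m (V \<inter> level fd (\<theta> - \<delta> * \<tau>)) \<partial>?n)"
    by (simp add: nn_integral_multc)
  also have "\<dots> \<le> (\<integral>\<^sup>+u. emeasure ?m {v. v + u \<in> A} \<partial>?n)"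
    using AE_W low by (intro nn_integral_mono_AE) auto
  also have "\<dots> = ennreal (measure lborel A)"
    using emeasure_lborel_subspace[OF V A(1)] eA by simp
  finally have *: "measure ?n (?P \<tau>) * measure ?m (V \<inter> level fd (\<theta> - \<delta> * \<tau>)) \<le> measure lborel A"
    by (simp add: ennreal_le_iff)
  show ?lower
  \<comment> \<open>Homogeneity is available only for a positive radius, so the boundary case of
    radius 0 is separate. If \<open>V = {0}\<close>, the slices of radius 0 and 1 are both
    \<open>{0}\<close> and the zeroth power is 1; otherwise the power of 0 makes the claimed lower
    bound 0.\<close>
  proof (cases "0 < \<theta> - \<delta> * \<tau>")
    case True
    then show ?thesis
      using * by (simp add: P_scale slice_scale[of "\<theta> - \<delta> * \<tau>"] c_def mult_ac)
  next
    case False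
    then have 0: "\<theta> - \<delta> * \<tau> = 0"
      using \<theta> by simp
    show ?thesis
    proof (cases "dim V = 0")
      case True
      then have "V = {0}"
        using V subspace_0 by auto
      moreover have "fd 0 = 0"
        using is_norm_eq_0[OF fd] by simp
      ultimately have "V \<inter> level fd (\<theta> - \<delta> * \<tau>) = V \<inter> level fd 1"
        by (auto simp: level_def 0)
      then show ?thesis
        using * unfolding P_scale c_def True by (simp add: mult_ac)
    next
      case False
      show ?thesis
        unfolding 0 power_0_left if_not_P[OF False] by simp
    qed
  qed
qed

text \<open>The correction runs over ordered pairs, so every overlap is counted twice. This matches
  \<open>H\<close> and \<open>Q_bar\<close>, which also collect ordered pairs.\<close>

lemma measure_UN_Bonferroni:
  assumes "finite S" "\<And>i. i \<in> S \<Longrightarrow> A i \<in> fmeasurable M"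
  shows "(\<Sum>i\<in>S. measure M (A i)) -
      (\<Sum>(i, j)\<in>{(i, j). i \<in> S \<and> j \<in> S \<and> i \<noteq> j}. measure M (A i \<inter> A j))
    \<le> measure M (\<Union>i\<in>S. A i)"
  using assms
proof (induction S rule: finite_induct)
  case (insert x S)
  let ?U = "\<Union>i\<in>S. A i" and ?R = "\<lambda>S. {(i, j). i \<in> S \<and> j \<in> S \<and> i \<noteq> j}"
  let ?g = "\<lambda>(i, j). measure M (A i \<inter> A j)"
  have U: "?U \<in> fmeasurable M" and x: "A x \<in> fmeasurable M"
    using insert by (auto intro!: fmeasurable.finite_UN)
  have fin: "finite (?R (insert x S))"
    by (rule finite_subset[of _ "insert x S \<times> insert x S"]) (use insert in auto)
  have "measure M (?U \<inter> A x) \<le> (\<Sum>i\<in>S. measure M (A i \<inter> A x))"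
  proof -
    have eq: "?U \<inter> A x = (\<Union>i\<in>S. A i \<inter> A x)"
      by auto
    show ?thesis
      unfolding eq using insert by (intro measure_UNION_le) auto
  qed
  moreover have "(\<Sum>i\<in>S. measure M (A i \<inter> A x)) = sum ?g ((\<lambda>i. (i, x)) ` S)"
    by (subst sum.reindex) (auto simp: inj_on_def)
  moreover have "sum ?g (?R S) + sum ?g ((\<lambda>i. (i, x)) ` S) = sum ?g (?R S \<union> (\<lambda>i. (i, x)) ` S)"
    using insert by (intro sum.union_disjoint[symmetric] finite_subset[OF _ fin]) auto
  \<comment> \<open>Only the pairs \<open>(i, x)\<close> pay for the new overlap; the mirrored pairs
    \<open>(x, i)\<close> add nonnegative terms.\<close>
  moreover have "\<dots> \<le> sum ?g (?R (insert x S))"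
    using insert fin by (intro sum_mono2) auto
  moreover have "measure M (?U \<union> A x) = measure M ?U + measure M (A x) - measure M (?U \<inter> A x)"
    using U x by (subst measure_Un3) auto
  ultimately have "(\<Sum>i\<in>insert x S. measure M (A i)) - sum ?g (?R (insert x S)) \<le> measure M (?U \<union> A x)"
    using insert by simp
  then show ?case
    by (simp add: Un_commute)
qed simp

subsection \<open>Sparse representations and dictionary subspaces\<close>

lemma subspace_T: "subspace (T \<psi> J)"
  by (simp add: T_def)

lemma T_mono: "J \<subseteq> J' \<Longrightarrow> T \<psi> J \<subseteq> T \<psi> J'"
  unfolding T_def by (intro span_mono image_mono)

lemma T_thick_eq_thick: "T_thick \<psi> f t J = thick (T \<psi> J) f t"
  by (simp add: T_thick_def thick_def)

text \<open>Some atoms indexed by \<open>J\<close> already form a basis of the span. Choosing one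
  index per basis vector, which also handles repeated atoms, bounds the support by the dimension
  instead of by \<open>card J\<close>.\<close>

lemma T_sparse:
  fixes \<psi> :: "'i \<Rightarrow> 'a::euclidean_space"
  assumes "finite I" "J \<subseteq> I" "x \<in> T \<psi> J"
  obtains l where "x = (\<Sum>i\<in>I. l i *\<^sub>R \<psi> i)" "card {i\<in>I. l i \<noteq> 0} \<le> dim (T \<psi> J)"
proof -
  obtain B where B: "B \<subseteq> \<psi> ` J" "independent B" "\<psi> ` J \<subseteq> span B" "card B = dim (\<psi> ` J)"
    using basis_exists[of "\<psi> ` J"] by metis
  obtain J' where J': "J' \<subseteq> J" "inj_on \<psi> J'" "B = \<psi> ` J'"
    using B(1) by (auto simp: subset_image_inj)
  have fin: "finite J'"
    using J'(1) assms finite_subset by metis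
  have "x \<in> span B"
    using assms(3) B(3) span_minimal[OF B(3) subspace_span] unfolding T_def by auto
  then obtain r where "x = (\<Sum>b\<in>B. r b *\<^sub>R b)"
    using span_finite[of B] fin J'(3) by auto
  then have r: "x = (\<Sum>i\<in>J'. r (\<psi> i) *\<^sub>R \<psi> i)"
    by (simp add: J'(3) sum.reindex[OF J'(2)])
  define l where "l i = (if i \<in> J' then r (\<psi> i) else 0)" for i
  show thesis
  proof
    show "x = (\<Sum>i\<in>I. l i *\<^sub>R \<psi> i)"
      unfolding r using J'(1) assms
      by (intro sum.mono_neutral_cong_left) (auto simp: l_def)
    have "card {i\<in>I. l i \<noteq> 0} \<le> card J'"
      using fin by (intro card_mono) (auto simp: l_def split: if_splits)
    also have "card J' = dim (T \<psi> J)"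
      using B(4) J' by (simp add: T_def card_image)
    finally show "card {i\<in>I. l i \<noteq> 0} \<le> dim (T \<psi> J)" .
  qed
qed

text \<open>As long as the span is proper, some atom lies outside it, and adding that atom raises
  the dimension by exactly one. This brings supports of lower dimension into the scope of the
  K-dimensional representatives.\<close>

lemma T_extend:
  fixes \<psi> :: "'i \<Rightarrow> 'a::euclidean_space"
  assumes "span (\<psi> ` I) = UNIV" "J \<subseteq> I" "dim (T \<psi> J) \<le> K" "K \<le> DIM('a)"
  shows "\<exists>J'. J \<subseteq> J' \<and> J' \<subseteq> I \<and> dim (T \<psi> J') = K"
  using assms(3,4)
proof (induction K rule: dec_induct)
  case base
  then show ?case
    using assms(2) by blast
next
  case (step K)
  then obtain J' where J': "J \<subseteq> J'" "J' \<subseteq> I" "dim (T \<psi> J') = K"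
    by auto
  have "\<exists>i\<in>I. \<psi> i \<notin> T \<psi> J'"
  proof (rule ccontr)
    assume "\<not> (\<exists>i\<in>I. \<psi> i \<notin> T \<psi> J')"
    then have "span (\<psi> ` I) \<subseteq> T \<psi> J'"
      by (intro span_minimal subspace_T) auto
    then have "T \<psi> J' = UNIV"
      using assms(1) by auto
    then show False
      using J'(3) step by simp
  qed
  then obtain i where i: "i \<in> I" "\<psi> i \<notin> span (\<psi> ` J')"
    by (auto simp: T_def)
  have "dim (T \<psi> (insert i J')) = Suc K"
    using i(2) J'(3) by (simp add: T_def dim_insert)
  then show ?case
    using J' i(1) by (intro exI[of _ "insert i J'"]) auto
qed

text \<open>The minimum is attained because \<open>x\<close> itself has an exact expansion in the
  dictionary; afterwards the \<open>LEAST\<close> operator can be forgotten.\<close>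

lemma val_P_le_iff_sparse:
  fixes \<psi> :: "'i \<Rightarrow> 'a::euclidean_space"
  assumes "finite I" "span (\<psi> ` I) = UNIV" "is_norm f" "0 \<le> \<tau>"
  shows "val_P I \<psi> f \<tau> x \<le> m \<longleftrightarrow>
    (\<exists>l. f ((\<Sum>i\<in>I. l i *\<^sub>R \<psi> i) - x) \<le> \<tau> \<and> card {i\<in>I. l i \<noteq> 0} \<le> m)"
proof -
  let ?P = "\<lambda>m. \<exists>l. f ((\<Sum>i\<in>I. l i *\<^sub>R \<psi> i) - x) \<le> \<tau> \<and> m = card {i\<in>I. l i \<noteq> 0}"
  have "x \<in> T \<psi> I"
    using assms(2) by (simp add: T_def)
  then obtain l where "x = (\<Sum>i\<in>I. l i *\<^sub>R \<psi> i)"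
    by (rule T_sparse[OF assms(1) subset_refl])
  then have "f ((\<Sum>i\<in>I. l i *\<^sub>R \<psi> i) - x) \<le> \<tau>"
    using is_norm_eq_0[OF assms(3), of 0] assms(4) by simp
  then have "?P (card {i\<in>I. l i \<noteq> 0})"
    by blast
  then have 1: "?P (val_P I \<psi> f \<tau> x)"
    unfolding val_P_def by (rule LeastI)
  have 2: "val_P I \<psi> f \<tau> x \<le> k" if "?P k" for k
    unfolding val_P_def using that by (rule Least_le)
  show ?thesis
  proof
    assume "val_P I \<psi> f \<tau> x \<le> m"
    then show "\<exists>l. f ((\<Sum>i\<in>I. l i *\<^sub>R \<psi> i) - x) \<le> \<tau> \<and> card {i\<in>I. l i \<noteq> 0} \<le> m"
      using 1 by auto
  next
    assume "\<exists>l. f ((\<Sum>i\<in>I. l i *\<^sub>R \<psi> i) - x) \<le> \<tau> \<and> card {i\<in>I. l i \<noteq> 0} \<le> m"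
    then obtain l where "f ((\<Sum>i\<in>I. l i *\<^sub>R \<psi> i) - x) \<le> \<tau>" "card {i\<in>I. l i \<noteq> 0} \<le> m"
      by blast
    then show "val_P I \<psi> f \<tau> x \<le> m"
      using 2[of "card {i\<in>I. l i \<noteq> 0}"] by (auto intro: order.trans)
  qed
qed

lemma val_P_le_iff_T_thick:
  fixes \<psi> :: "'i \<Rightarrow> real^'n"
  assumes "finite I" "span (\<psi> ` I) = UNIV" "is_norm f" "0 \<le> \<tau>" "representatives I \<psi> \<J>"
    and K: "K \<le> CARD('n)"
  shows "val_P I \<psi> f \<tau> x \<le> K \<longleftrightarrow> x \<in> (\<Union>J\<in>\<J> K. T_thick \<psi> f \<tau> J)"
  unfolding val_P_le_iff_sparse[OF assms(1-4)] T_thick_eq_thick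
proof
  assume "\<exists>l. f ((\<Sum>i\<in>I. l i *\<^sub>R \<psi> i) - x) \<le> \<tau> \<and> card {i\<in>I. l i \<noteq> 0} \<le> K"
  then obtain l where l: "f ((\<Sum>i\<in>I. l i *\<^sub>R \<psi> i) - x) \<le> \<tau>" "card {i\<in>I. l i \<noteq> 0} \<le> K"
    by blast
  let ?J = "{i\<in>I. l i \<noteq> 0}"
  have "dim (T \<psi> ?J) \<le> card (\<psi> ` ?J)"
    using assms(1) by (simp add: T_def dim_le_card')
  also have "\<dots> \<le> card ?J"
    using assms(1) by (intro card_image_le) simp
  finally have "dim (T \<psi> ?J) \<le> K"
    using l(2) by simp
  \<comment> \<open>The support may be small or dependent, so its span is enlarged to dimension
    exactly \<open>K\<close> before a representative is chosen.\<close>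
  then have "\<exists>J'. ?J \<subseteq> J' \<and> J' \<subseteq> I \<and> dim (T \<psi> J') = K"
    using K by (intro T_extend[OF assms(2)]) auto
  then obtain J' where J': "?J \<subseteq> J'" "J' \<subseteq> I" "dim (T \<psi> J') = K"
    by blast
  have "\<forall>J1\<subseteq>I. dim (T \<psi> J1) = K \<longrightarrow> (\<exists>J\<in>\<J> K. T \<psi> J1 = T \<psi> J)"
    using assms(5) K by (simp add: representatives_def)
  then obtain J where J: "J \<in> \<J> K" "T \<psi> J' = T \<psi> J"
    using J'(2,3) by blast
  have "(\<Sum>i\<in>I. l i *\<^sub>R \<psi> i) = (\<Sum>i\<in>?J. l i *\<^sub>R \<psi> i)"
    using assms(1) by (intro sum.mono_neutral_right) auto
  also have "\<dots> \<in> T \<psi> ?J"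
    unfolding T_def by (intro span_sum span_scale span_base imageI)
  finally have "(\<Sum>i\<in>I. l i *\<^sub>R \<psi> i) \<in> T \<psi> J"
    using T_mono[OF J'(1), of \<psi>] J(2) by auto
  then show "x \<in> (\<Union>J\<in>\<J> K. thick (T \<psi> J) f \<tau>)"
    using J(1) l(1) mem_thick_iff[OF subspace_T assms(3)] by blast
next
  assume "x \<in> (\<Union>J\<in>\<J> K. thick (T \<psi> J) f \<tau>)"
  then obtain J v where J: "J \<in> \<J> K" "v \<in> T \<psi> J" "f (v - x) \<le> \<tau>"
    using mem_thick_iff[OF subspace_T assms(3)] by blast
  then have sub: "J \<subseteq> I" and dim: "dim (T \<psi> J) = K"
    using assms(5) K by (auto simp: representatives_def)
  obtain l where "v = (\<Sum>i\<in>I. l i *\<^sub>R \<psi> i)" "card {i\<in>I. l i \<noteq> 0} \<le> dim (T \<psi> J)"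
    using T_sparse[OF assms(1) sub J(2)] .
  then show "\<exists>l. f ((\<Sum>i\<in>I. l i *\<^sub>R \<psi> i) - x) \<le> \<tau> \<and> card {i\<in>I. l i \<noteq> 0} \<le> K"
    using J(3) dim by auto
qed

text \<open>Normalises a term of degree \<open>N\<close> by \<open>\<theta> ^ N\<close>. The sign of
  \<open>a\<close> is free: \<open>thick_prob_lower\<close> applies it with a negated
  constant.\<close>

lemma power_ratio_split:
  fixes \<tau> \<theta> a :: real
  assumes "0 < \<theta>" "k \<le> N"
  shows "\<tau> ^ (N - k) * (\<theta> + a * \<tau>) ^ k / \<theta> ^ N = (\<tau> / \<theta>) ^ (N - k) * (1 + a * (\<tau> / \<theta>)) ^ k"
proof -
  have "1 + a * (\<tau> / \<theta>) = (\<theta> + a * \<tau>) / \<theta>"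
    using assms(1) by (simp add: field_simps)
  moreover have "\<theta> ^ N = \<theta> ^ (N - k) * \<theta> ^ k"
    using assms(2) by (simp flip: power_add)
  ultimately show ?thesis
    by (simp add: power_divide)
qed

text \<open>A union bound for nonnegative sums, used to distribute the pairs of distinct
  representatives over the classes \<open>H\<close>.\<close>

lemma sum_le_sum_cover:
  fixes g :: "'b \<Rightarrow> real"
  assumes "finite R" "finite \<K>" "\<And>k. k \<in> \<K> \<Longrightarrow> finite (D k)" "R \<subseteq> (\<Union>k\<in>\<K>. D k)" "\<And>x. 0 \<le> g x"
  shows "sum g R \<le> (\<Sum>k\<in>\<K>. sum g (D k))"
proof -
  have "sum g R \<le> sum g (\<Union>k\<in>\<K>. D k)"
    using assms by (intro sum_mono2) auto
  also have "\<dots> \<le> (\<Sum>k\<in>\<K>. sum g (D k))"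
    using assms(2,3)
  proof (induction \<K> rule: finite_induct)
    case (insert k \<K>)
    have "sum g (D k \<union> (\<Union>k\<in>\<K>. D k)) \<le> sum g (D k) + sum g (\<Union>k\<in>\<K>. D k)"
      using insert assms(5) by (subst sum.union_inter[symmetric]) (auto intro!: sum_nonneg)
    then show ?case
      using insert by simp
  qed simp
  finally show ?thesis .
qed

subsection \<open>Probability that the optimal value is at most \<open>K\<close>\<close>

text \<open>Holds the deterministic data; probability enters only with
  \<open>expectation_val_P\<close>.\<close>

locale sparse_approximation =
  fixes I :: "'i set" and \<psi> :: "'i \<Rightarrow> real^'n"
    and nm fd :: "real^'n \<Rightarrow> real"
    and \<delta>1 \<delta>2 :: real
    and \<J> :: "nat \<Rightarrow> 'i set set"
    and \<delta> :: "'i set \<Rightarrow> real" and \<delta>' :: "'i set \<Rightarrow> 'i set \<Rightarrow> real"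
  assumes norms: "is_norm nm" "is_norm fd"
    and dictionary: "finite I" "span (\<psi> ` I) = UNIV"
    and delta_J: "\<And>J. J \<subseteq> I \<Longrightarrow>
          0 \<le> \<delta> J \<and> \<delta> J \<le> \<delta>1 * \<delta>2 \<and> (\<forall>u\<in>(T \<psi> J)\<^sup>\<bottom>. fd u \<le> \<delta> J * h \<psi> nm J u)"
    and J: "representatives I \<psi> \<J>"
    and delta_J1_J2: "\<And>K k J1 J2. K \<le> CARD('n) \<Longrightarrow> k < K \<Longrightarrow> (J1, J2) \<in> H \<psi> \<J> K k \<Longrightarrow>
          0 \<le> \<delta>' J1 J2 \<and> \<delta>' J1 J2 \<le> 3 * (\<delta>1 * \<delta>2) \<and>
          (\<forall>\<tau>>0. \<forall>\<theta>>0. \<delta>' J1 J2 * \<tau> \<le> \<theta> \<longrightarrow>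
             measure lborel (T_thick \<psi> nm \<tau> J1 \<inter> T_thick \<psi> nm \<tau> J2 \<inter> level fd \<theta>)
             \<le> Q \<psi> fd \<delta>2 J1 J2 * \<tau> ^ (CARD('n) - k) * (\<theta> + \<delta>' J1 J2 * \<tau>) ^ k)"
begin

abbreviation L :: real where "L \<equiv> measure lborel (level fd 1)"

definition thick_union :: "nat \<Rightarrow> real \<Rightarrow> (real^'n) set" where
  "thick_union K \<tau> = (\<Union>J\<in>\<J> K. T_thick \<psi> nm \<tau> J)"

text \<open>By homogeneity the denominator is the volume of \<open>level fd \<theta>\<close>, so for
  positive \<open>\<theta>\<close> this is the probability that the optimal value is at most
  \<open>K\<close>. The explicit power of \<open>\<theta>\<close> suits
  \<open>power_ratio_split\<close>.\<close>

definition thick_prob :: "nat \<Rightarrow> real \<Rightarrow> real \<Rightarrow> real" where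
  "thick_prob K \<tau> \<theta> = measure lborel (thick_union K \<tau> \<inter> level fd \<theta>) / (\<theta> ^ CARD('n) * L)"

section \<open>Elementary facts on representatives and constants\<close>

lemma L_pos: "0 < L"
  using measure_level_pos[OF norms(2), of 1] by simp

lemma J_subset: "K \<le> CARD('n) \<Longrightarrow> J \<in> \<J> K \<Longrightarrow> J \<subseteq> I"
  and J_dim: "K \<le> CARD('n) \<Longrightarrow> J \<in> \<J> K \<Longrightarrow> dim (T \<psi> J) = K"
  and J_inj: "K \<le> CARD('n) \<Longrightarrow> inj_on (T \<psi>) (\<J> K)"
  and J_0: "\<J> 0 = {{}}"
  using J by (auto simp: representatives_def)

lemma J_finite: "K \<le> CARD('n) \<Longrightarrow> finite (\<J> K)"
  using J_subset dictionary(1) by (intro finite_subset[of "\<J> K" "Pow I"]) auto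

lemma H_finite: "K \<le> CARD('n) \<Longrightarrow> finite (H \<psi> \<J> K k)"
  using J_finite by (intro finite_subset[of "H \<psi> \<J> K k" "\<J> K \<times> \<J> K"]) (auto simp: H_def)

lemma delta_nonneg: "K \<le> CARD('n) \<Longrightarrow> J \<in> \<J> K \<Longrightarrow> 0 \<le> \<delta> J"
  using delta_J J_subset by blast

lemma delta_le_delta_hat: "K \<le> CARD('n) \<Longrightarrow> J \<in> \<J> K \<Longrightarrow> \<delta> J \<le> delta_hat \<J> \<delta> K"
  unfolding delta_hat_def using J_finite by (intro Max_ge) auto

lemma delta'_le_delta_hat2:
  "K \<le> CARD('n) \<Longrightarrow> (J1, J2) \<in> H \<psi> \<J> K k \<Longrightarrow> \<delta>' J1 J2 \<le> delta_hat2 \<psi> \<J> \<delta>' K k"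
  unfolding delta_hat2_def using H_finite by (intro Max_ge) (auto intro: rev_image_eqI)

lemma delta_hat_le_Delta: "K \<le> CARD('n) \<Longrightarrow> delta_hat \<J> \<delta> K \<le> Delta \<psi> \<J> \<delta> \<delta>' K"
  by (cases K) (auto simp: Let_def)

lemma delta_hat2_le_Delta:
  assumes "0 < K" "K < CARD('n)" "k \<in> {2 * K - CARD('n)..K - 1}"
  shows "delta_hat2 \<psi> \<J> \<delta>' K k \<le> Delta \<psi> \<J> \<delta> \<delta>' K"
proof -
  obtain K' where K': "K = Suc K'"
    using assms(1) gr0_implies_Suc by blast
  have "delta_hat2 \<psi> \<J> \<delta>' K k \<le> Max (delta_hat2 \<psi> \<J> \<delta>' K ` {2 * K - CARD('n)..K - 1})"
    using assms(3) by (intro Max_ge) auto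
  also have "\<dots> \<le> Max {Delta \<psi> \<J> \<delta> \<delta>' K', delta_hat \<J> \<delta> K,
      Max (delta_hat2 \<psi> \<J> \<delta>' K ` {2 * K - CARD('n)..K - 1})}"
    by (rule Max_ge) simp_all
  also have "\<dots> = Delta \<psi> \<J> \<delta> \<delta>' K"
    unfolding K' Delta.simps(2) Let_def using assms(2) K' by simp
  finally show ?thesis .
qed

lemma C_nonneg: "0 \<le> C \<psi> nm fd J"
  by (simp add: C_def)

lemma Q_nonneg: "0 \<le> Q \<psi> fd \<delta>2 J1 J2"
  by (simp add: Q_def Let_def)

lemma T_thick_fmeasurable: "T_thick \<psi> nm \<tau> J \<inter> level fd \<theta> \<in> fmeasurable lborel"
proof -
  have "compact (T_thick \<psi> nm \<tau> J \<inter> level fd \<theta>)"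
    unfolding T_thick_eq_thick
    using closed_thick[OF subspace_T norms(1)] compact_level[OF norms(2)]
    by (rule closed_Int_compact)
  then show ?thesis
    by (rule fmeasurable_compact)
qed

text \<open>Derives the hypothesis \<open>dom\<close> of the general estimate from the gauge
  \<open>h\<close>: a point of the shadow of the \<open>\<tau>\<close>-level set, divided by
  \<open>\<tau>\<close>, lies in the shadow of the unit level set, hence has gauge at most
  \<open>\<tau>\<close>.\<close>

lemma measure_T_thick_bounds:
  assumes "K \<le> CARD('n)" "J \<in> \<J> K" "0 < \<tau>" "0 < \<theta>" "\<delta> J * \<tau> \<le> \<theta>"
  shows "measure lborel (T_thick \<psi> nm \<tau> J \<inter> level fd \<theta>)
      \<le> C \<psi> nm fd J * (\<tau> ^ (CARD('n) - K) * (\<theta> + \<delta> J * \<tau>) ^ K)" (is ?upper)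
    and "C \<psi> nm fd J * (\<tau> ^ (CARD('n) - K) * (\<theta> - \<delta> J * \<tau>) ^ K)
      \<le> measure lborel (T_thick \<psi> nm \<tau> J \<inter> level fd \<theta>)" (is ?lower)
proof -
  let ?V = "T \<psi> J"
  have dom: "fd u \<le> \<delta> J * \<tau>" if u: "u \<in> proj (?V\<^sup>\<bottom>) ` level nm \<tau>" for u
  proof -
    obtain x where x: "u = proj (?V\<^sup>\<bottom>) x" "x \<in> level nm \<tau>"
      using u by blast
    have "(1 / \<tau>) *\<^sub>R u = proj (?V\<^sup>\<bottom>) ((1 / \<tau>) *\<^sub>R x)"
      by (simp only: x(1) linear_cmul[OF linear_proj_orthogonal_comp[OF subspace_T]])
    moreover have "(1 / \<tau>) *\<^sub>R x \<in> level nm 1"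
      using x(2) assms(3) level_scale[OF norms(1), of "1 / \<tau>" x 1] by simp
    ultimately have "(1 / \<tau>) *\<^sub>R u \<in> proj (?V\<^sup>\<bottom>) ` level nm 1"
      by blast
    then have "h \<psi> nm J u \<le> \<tau>"
      unfolding h_def using assms(3)
      by (intro cInf_lower bdd_belowI[of _ 0]) auto
    moreover have "u \<in> ?V\<^sup>\<bottom>"
      using u by (simp add: proj_image_level[OF subspace_T])
    ultimately have "fd u \<le> \<delta> J * h \<psi> nm J u" "\<delta> J * h \<psi> nm J u \<le> \<delta> J * \<tau>"
      using delta_J[OF J_subset[OF assms(1,2)]] by (auto intro: mult_left_mono)
    then show ?thesis
      by simp
  qed
  show ?upper ?lower
    using measure_thick_bounds[OF subspace_T[of \<psi> J] norms assms(3,4,5) delta_nonneg[OF assms(1,2)] dom]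
      J_dim[OF assms(1,2)]
    by (simp_all add: C_def T_thick_eq_thick mult.assoc)
qed

lemma thick_prob_upper:
  assumes K: "K \<le> CARD('n)" and \<tau>: "0 < \<tau>" and \<theta>: "0 < \<theta>" "\<tau> * delta_hat \<J> \<delta> K \<le> \<theta>"
  shows "thick_prob K \<tau> \<theta> \<le>
    C_bar \<psi> nm fd \<J> K / L * (\<tau> / \<theta>) ^ (CARD('n) - K) * (1 + delta_hat \<J> \<delta> K * (\<tau> / \<theta>)) ^ K"
proof -
  let ?D = "delta_hat \<J> \<delta> K"
  have "measure lborel (thick_union K \<tau> \<inter> level fd \<theta>) =
      measure lborel (\<Union>J\<in>\<J> K. T_thick \<psi> nm \<tau> J \<inter> level fd \<theta>)"
    by (rule arg_cong[of _ _ "measure lborel"]) (auto simp: thick_union_def)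
  also have "\<dots> \<le> (\<Sum>J\<in>\<J> K. measure lborel (T_thick \<psi> nm \<tau> J \<inter> level fd \<theta>))"
    by (intro measure_UNION_le J_finite[OF K] fmeasurableD T_thick_fmeasurable)
  also have "\<dots> \<le> (\<Sum>J\<in>\<J> K. C \<psi> nm fd J * (\<tau> ^ (CARD('n) - K) * (\<theta> + ?D * \<tau>) ^ K))"
  proof (rule sum_mono)
    fix J assume J: "J \<in> \<J> K"
    have le: "\<delta> J * \<tau> \<le> ?D * \<tau>"
      using delta_le_delta_hat[OF K J] \<tau> by simp
    then have "measure lborel (T_thick \<psi> nm \<tau> J \<inter> level fd \<theta>)
      \<le> C \<psi> nm fd J * (\<tau> ^ (CARD('n) - K) * (\<theta> + \<delta> J * \<tau>) ^ K)"
      using \<theta> by (intro measure_T_thick_bounds K J \<tau>) (auto simp: mult.commute)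
    \<comment> \<open>Replacing \<open>\<delta> J\<close> by the common maximum only weakens the
      bound and makes the power independent of \<open>J\<close>.\<close>
    also have "\<dots> \<le> C \<psi> nm fd J * (\<tau> ^ (CARD('n) - K) * (\<theta> + ?D * \<tau>) ^ K)"
      using \<tau> \<theta> le delta_nonneg[OF K J] C_nonneg
      by (intro mult_left_mono power_mono) auto
    finally show "measure lborel (T_thick \<psi> nm \<tau> J \<inter> level fd \<theta>) \<le> \<dots>" .
  qed
  also have "\<dots> = C_bar \<psi> nm fd \<J> K * (\<tau> ^ (CARD('n) - K) * (\<theta> + ?D * \<tau>) ^ K)"
    by (simp add: C_bar_def sum_distrib_right)
  finally have "thick_prob K \<tau> \<theta> \<le>
      C_bar \<psi> nm fd \<J> K * (\<tau> ^ (CARD('n) - K) * (\<theta> + ?D * \<tau>) ^ K) / (\<theta> ^ CARD('n) * L)"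
    unfolding thick_prob_def using \<theta> L_pos by (intro divide_right_mono) auto
  also have "\<dots> = C_bar \<psi> nm fd \<J> K / L * (\<tau> ^ (CARD('n) - K) * (\<theta> + ?D * \<tau>) ^ K / \<theta> ^ CARD('n))"
    by simp
  finally show ?thesis
    by (simp only: power_ratio_split[OF \<theta>(1) K] mult.assoc)
qed

text \<open>Explains the range of \<open>k\<close>: the dimension formula for a sum of subspaces
  gives at least 2K - N, and an intersection of dimension \<open>K\<close> would equal both spans,
  although distinct representatives have distinct spans.\<close>

lemma offdiagonal_subset_H:
  assumes "0 < K" "K < CARD('n)" "J1 \<in> \<J> K" "J2 \<in> \<J> K" "J1 \<noteq> J2"
  shows "\<exists>k\<in>{2 * K - CARD('n)..K - 1}. (J1, J2) \<in> H \<psi> \<J> K k"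
proof
  let ?V1 = "T \<psi> J1" and ?V2 = "T \<psi> J2"
  have dims: "dim ?V1 = K" "dim ?V2 = K"
    using assms J_dim by auto
  have ne: "?V1 \<noteq> ?V2"
    using J_inj[of K] assms by (auto simp: inj_on_def)
  have "dim {x + y |x y. x \<in> ?V1 \<and> y \<in> ?V2} + dim (?V1 \<inter> ?V2) = dim ?V1 + dim ?V2"
    by (rule dim_sums_Int) (auto simp: subspace_T)
  moreover have "dim {x + y |x y. x \<in> ?V1 \<and> y \<in> ?V2} \<le> CARD('n)"
    using dim_subset_UNIV[of "{x + y |x y. x \<in> ?V1 \<and> y \<in> ?V2}"] by simp
  moreover have "dim (?V1 \<inter> ?V2) \<noteq> K"
  proof
    assume *: "dim (?V1 \<inter> ?V2) = K"
    have "?V1 \<inter> ?V2 = ?V1"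
      by (rule subspace_dim_equal) (simp_all add: subspace_inter subspace_T * dims)
    moreover have "?V1 \<inter> ?V2 = ?V2"
      by (rule subspace_dim_equal) (simp_all add: subspace_inter subspace_T * dims)
    ultimately show False
      using ne by auto
  qed
  moreover have "dim (?V1 \<inter> ?V2) \<le> K"
    using dim_subset[of "?V1 \<inter> ?V2" ?V1] dims by auto
  ultimately show "dim (?V1 \<inter> ?V2) \<in> {2 * K - CARD('n)..K - 1}"
    using dims by auto
  show "(J1, J2) \<in> H \<psi> \<J> K (dim (?V1 \<inter> ?V2))"
    using assms by (simp add: H_def)
qed

text \<open>Controls the Bonferroni correction. The factor \<open>\<theta> ^ CARD('n)\<close> turns
  \<open>eps0\<close>, a function of the ratio, back into a volume.\<close>

lemma measure_overlap_bound:
  assumes K: "K < CARD('n)" and \<tau>: "0 < \<tau>" and \<theta>: "0 < \<theta>" "\<tau> * Delta \<psi> \<J> \<delta> \<delta>' K \<le> \<theta>"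
  shows "(\<Sum>(J1, J2)\<in>{(J1, J2). J1 \<in> \<J> K \<and> J2 \<in> \<J> K \<and> J1 \<noteq> J2}.
      measure lborel (T_thick \<psi> nm \<tau> J1 \<inter> level fd \<theta> \<inter> (T_thick \<psi> nm \<tau> J2 \<inter> level fd \<theta>)))
    \<le> eps0 \<psi> fd \<delta>2 \<J> \<delta>' K \<tau> \<theta> * \<theta> ^ CARD('n)" (is "sum ?g ?R \<le> _")
proof (cases "K = 0")
  case True
  \<comment> \<open>The empty set is the only representative of dimension 0, so there are no
    pairs.\<close>
  then have R: "?R = {}"
    by (auto simp: J_0)
  show ?thesis
    unfolding R using True by (simp add: eps0_def)
next
  case False
  let ?K = "{2 * K - CARD('n)..K - 1}" and ?D = "delta_hat2 \<psi> \<J> \<delta>' K"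
  have "sum ?g ?R \<le> (\<Sum>k\<in>?K. sum ?g (H \<psi> \<J> K k))"
  proof (rule sum_le_sum_cover)
    show "finite ?R"
      using J_finite[of K] K by (intro finite_subset[of ?R "\<J> K \<times> \<J> K"]) auto
    show "?R \<subseteq> (\<Union>k\<in>?K. H \<psi> \<J> K k)"
      using offdiagonal_subset_H[of K] False K by fastforce
  qed (use H_finite K in \<open>auto split: prod.split\<close>)
  also have "\<dots> \<le> (\<Sum>k\<in>?K. Q_bar \<psi> fd \<delta>2 \<J> K k * (\<tau> ^ (CARD('n) - k) * (\<theta> + ?D k * \<tau>) ^ k))"
  proof (rule sum_mono)
    fix k assume k: "k \<in> ?K"
    then have "k < K"
      using False by auto
    \<comment> \<open>This is where \<open>Delta\<close> has to dominate the constants for pairs: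
      the assumed overlap bound is available only when \<open>\<theta>\<close> is at least
      \<open>\<delta>' J1 J2 * \<tau>\<close>.\<close>
    have D: "\<tau> * ?D k \<le> \<theta>"
      using delta_hat2_le_Delta[OF _ K k] False \<theta>(2) \<tau>
      by (meson mult_left_mono less_imp_le order.trans gr0I)
    have "sum ?g (H \<psi> \<J> K k) \<le>
        (\<Sum>(J1, J2)\<in>H \<psi> \<J> K k. Q \<psi> fd \<delta>2 J1 J2 * (\<tau> ^ (CARD('n) - k) * (\<theta> + ?D k * \<tau>) ^ k))"
    proof (rule sum_mono, clarify)
      fix J1 J2 assume H: "(J1, J2) \<in> H \<psi> \<J> K k"
      have le: "\<delta>' J1 J2 * \<tau> \<le> ?D k * \<tau>"
        using delta'_le_delta_hat2[OF _ H] K \<tau> by simp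
      have le_\<theta>: "\<delta>' J1 J2 * \<tau> \<le> \<theta>"
        using order.trans[OF le] D by (simp add: mult.commute)
      note d = delta_J1_J2[OF less_imp_le[OF K] \<open>k < K\<close> H]
      have "measure lborel (T_thick \<psi> nm \<tau> J1 \<inter> level fd \<theta> \<inter> (T_thick \<psi> nm \<tau> J2 \<inter> level fd \<theta>)) =
          measure lborel (T_thick \<psi> nm \<tau> J1 \<inter> T_thick \<psi> nm \<tau> J2 \<inter> level fd \<theta>)"
        by (rule arg_cong[of _ _ "measure lborel"]) auto
      also have "\<dots> \<le> Q \<psi> fd \<delta>2 J1 J2 * \<tau> ^ (CARD('n) - k) * (\<theta> + \<delta>' J1 J2 * \<tau>) ^ k"
        using d \<tau> \<theta>(1) le_\<theta> by blast
      also have "\<dots> \<le> Q \<psi> fd \<delta>2 J1 J2 * \<tau> ^ (CARD('n) - k) * (\<theta> + ?D k * \<tau>) ^ k"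
        using d \<tau> \<theta>(1) le Q_nonneg by (intro mult_left_mono power_mono) auto
      finally show "measure lborel (T_thick \<psi> nm \<tau> J1 \<inter> level fd \<theta> \<inter> (T_thick \<psi> nm \<tau> J2 \<inter> level fd \<theta>))
          \<le> Q \<psi> fd \<delta>2 J1 J2 * (\<tau> ^ (CARD('n) - k) * (\<theta> + ?D k * \<tau>) ^ k)"
        by (simp add: mult.assoc)
    qed
    also have "\<dots> = Q_bar \<psi> fd \<delta>2 \<J> K k * (\<tau> ^ (CARD('n) - k) * (\<theta> + ?D k * \<tau>) ^ k)"
      unfolding Q_bar_def sum_distrib_right by (rule sum.cong) auto
    finally show "sum ?g (H \<psi> \<J> K k) \<le> \<dots>" .
  qed
  also have "\<dots> = (\<Sum>k\<in>?K. Q_bar \<psi> fd \<delta>2 \<J> K k * ((\<tau> / \<theta>) ^ (CARD('n) - k) * (1 + ?D k * (\<tau> / \<theta>)) ^ k)) * \<theta> ^ CARD('n)"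
    unfolding sum_distrib_right
  proof (rule sum.cong)
    fix k assume "k \<in> ?K"
    then have "k \<le> CARD('n)"
      using K by auto
    then show "Q_bar \<psi> fd \<delta>2 \<J> K k * (\<tau> ^ (CARD('n) - k) * (\<theta> + ?D k * \<tau>) ^ k) =
        Q_bar \<psi> fd \<delta>2 \<J> K k * ((\<tau> / \<theta>) ^ (CARD('n) - k) * (1 + ?D k * (\<tau> / \<theta>)) ^ k) * \<theta> ^ CARD('n)"
      unfolding power_ratio_split[OF \<theta>(1) \<open>k \<le> CARD('n)\<close>, symmetric] using \<theta>(1) by simp
  qed simp
  also have "\<dots> = eps0 \<psi> fd \<delta>2 \<J> \<delta>' K \<tau> \<theta> * \<theta> ^ CARD('n)"
    using False K by (simp add: eps0_def mult.assoc)
  finally show ?thesis .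
qed

lemma thick_prob_lower:
  assumes K: "K < CARD('n)" and \<tau>: "0 < \<tau>" and \<theta>: "0 < \<theta>" "\<tau> * Delta \<psi> \<J> \<delta> \<delta>' K \<le> \<theta>"
  shows "C_bar \<psi> nm fd \<J> K / L * (\<tau> / \<theta>) ^ (CARD('n) - K) * (1 - delta_hat \<J> \<delta> K * (\<tau> / \<theta>)) ^ K
      - eps0 \<psi> fd \<delta>2 \<J> \<delta>' K \<tau> \<theta> / L \<le> thick_prob K \<tau> \<theta>"
proof -
  let ?D = "delta_hat \<J> \<delta> K" and ?e = "eps0 \<psi> fd \<delta>2 \<J> \<delta>' K \<tau> \<theta>"
  have K': "K \<le> CARD('n)"
    using K by simp
  have D: "\<tau> * ?D \<le> \<theta>"
    using order.trans[OF mult_left_mono[OF delta_hat_le_Delta[OF K'], of \<tau>] \<theta>(2)] \<tau> by simp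
  have "C_bar \<psi> nm fd \<J> K * (\<tau> ^ (CARD('n) - K) * (\<theta> - ?D * \<tau>) ^ K) =
      (\<Sum>J\<in>\<J> K. C \<psi> nm fd J * (\<tau> ^ (CARD('n) - K) * (\<theta> - ?D * \<tau>) ^ K))"
    by (simp add: C_bar_def sum_distrib_right)
  also have "\<dots> \<le> (\<Sum>J\<in>\<J> K. measure lborel (T_thick \<psi> nm \<tau> J \<inter> level fd \<theta>))"
  proof (rule sum_mono)
    fix J assume J: "J \<in> \<J> K"
    have le: "\<delta> J * \<tau> \<le> ?D * \<tau>"
      using delta_le_delta_hat[OF K' J] \<tau> by simp
    \<comment> \<open>Monotonicity of the power requires the smaller base
      \<open>\<theta> - ?D * \<tau>\<close> to be nonnegative, which is \<open>D\<close>.\<close>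
    have "C \<psi> nm fd J * (\<tau> ^ (CARD('n) - K) * (\<theta> - ?D * \<tau>) ^ K)
        \<le> C \<psi> nm fd J * (\<tau> ^ (CARD('n) - K) * (\<theta> - \<delta> J * \<tau>) ^ K)"
      using \<tau> D le C_nonneg by (intro mult_left_mono power_mono) (auto simp: mult.commute)
    also have "\<dots> \<le> measure lborel (T_thick \<psi> nm \<tau> J \<inter> level fd \<theta>)"
      using \<theta> D le by (intro measure_T_thick_bounds K' J \<tau>) (auto simp: mult.commute)
    finally show "C \<psi> nm fd J * (\<tau> ^ (CARD('n) - K) * (\<theta> - ?D * \<tau>) ^ K)
        \<le> measure lborel (T_thick \<psi> nm \<tau> J \<inter> level fd \<theta>)" .
  qed
  finally have "C_bar \<psi> nm fd \<J> K * (\<tau> ^ (CARD('n) - K) * (\<theta> - ?D * \<tau>) ^ K) - ?e * \<theta> ^ CARD('n)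
      \<le> measure lborel (\<Union>J\<in>\<J> K. T_thick \<psi> nm \<tau> J \<inter> level fd \<theta>)"
    using measure_UN_Bonferroni[OF J_finite[OF K'], of "\<lambda>J. T_thick \<psi> nm \<tau> J \<inter> level fd \<theta>" lborel]
      T_thick_fmeasurable measure_overlap_bound[OF assms] by fastforce
  also have "\<dots> = measure lborel (thick_union K \<tau> \<inter> level fd \<theta>)"
    by (rule arg_cong[of _ _ "measure lborel"]) (auto simp: thick_union_def)
  finally have "(C_bar \<psi> nm fd \<J> K * (\<tau> ^ (CARD('n) - K) * (\<theta> - ?D * \<tau>) ^ K) - ?e * \<theta> ^ CARD('n)) / (\<theta> ^ CARD('n) * L)
      \<le> thick_prob K \<tau> \<theta>"
    unfolding thick_prob_def using \<theta> L_pos by (intro divide_right_mono) auto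
  moreover have "(C_bar \<psi> nm fd \<J> K * (\<tau> ^ (CARD('n) - K) * (\<theta> - ?D * \<tau>) ^ K) - ?e * \<theta> ^ CARD('n)) / (\<theta> ^ CARD('n) * L) =
      C_bar \<psi> nm fd \<J> K / L * (\<tau> ^ (CARD('n) - K) * (\<theta> + (- ?D) * \<tau>) ^ K / \<theta> ^ CARD('n)) - ?e / L"
    using \<theta>(1) by (simp add: diff_divide_distrib)
  ultimately show ?thesis
    unfolding power_ratio_split[OF \<theta>(1) K'] by (simp add: mult.assoc)
qed

lemma thick_union_sets: "K \<le> CARD('n) \<Longrightarrow> thick_union K \<tau> \<in> sets borel"
  unfolding thick_union_def T_thick_eq_thick
  using J_finite closed_thick[OF subspace_T norms(1)] by (intro borel_closed closed_UN) auto

text \<open>A natural number equals the number of naturals strictly below it; each summand tests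
  whether \<open>K\<close> is below the optimal value.\<close>

lemma val_P_eq_sum:
  assumes "0 \<le> \<tau>"
  shows "real (val_P I \<psi> nm \<tau> x) = (\<Sum>K = 0..CARD('n) - 1. 1 - indicator (thick_union K \<tau>) x)"
proof -
  note le = val_P_le_iff_sparse[OF dictionary norms(1) assms]
  let ?v = "val_P I \<psi> nm \<tau> x"
  have ind: "indicator (thick_union K \<tau>) x = (of_bool (?v \<le> K) :: real)" if "K \<le> CARD('n)" for K
    using val_P_le_iff_T_thick[OF dictionary norms(1) assms J that]
    by (simp add: thick_union_def indicator_def)
  have "x \<in> T \<psi> I"
    using dictionary(2) by (simp add: T_def)
  then obtain l where "x = (\<Sum>i\<in>I. l i *\<^sub>R \<psi> i)" "card {i\<in>I. l i \<noteq> 0} \<le> dim (T \<psi> I)"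
    by (rule T_sparse[OF dictionary(1) subset_refl])
  moreover have "dim (T \<psi> I) = CARD('n)"
    by (simp add: T_def dictionary(2) del: dim_span)
  ultimately have v: "?v \<le> CARD('n)"
    unfolding le using is_norm_eq_0[OF norms(1), of 0] assms by (intro exI[of _ l]) simp
  have "(\<Sum>K = 0..CARD('n) - 1. 1 - indicator (thick_union K \<tau>) x) = (\<Sum>K = 0..CARD('n) - 1. of_bool (K < ?v) :: real)"
    by (rule sum.cong) (auto simp: ind)
  \<comment> \<open>The value is at most \<open>CARD('n)\<close>, which is positive, so the range up
    to \<open>CARD('n) - 1\<close> contains every \<open>K < ?v\<close>.\<close>
  also have "\<dots> = (\<Sum>K<?v. 1)"
    using v zero_less_card_finite[where 'a = 'n] by (intro sum.mono_neutral_cong_right) auto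
  finally show ?thesis
    by simp
qed

lemma expectation_val_P:
  assumes "prob_space M" "d \<in> borel_measurable M"
    and unif: "distr M lborel d = uniform_measure lborel (level fd \<theta>)"
    and "0 < \<tau>" "0 < \<theta>"
  shows "(\<integral>\<omega>. real (val_P I \<psi> nm \<tau> (d \<omega>)) \<partial>M) = real CARD('n) - (\<Sum>K = 0..CARD('n) - 1. thick_prob K \<tau> \<theta>)"
proof -
  interpret prob_space M by fact
  have le_N: "K \<le> CARD('n)" if "K \<in> {0..CARD('n) - 1}" for K
    using that by auto
  have prob: "measure M {\<omega> \<in> space M. d \<omega> \<in> thick_union K \<tau>} = thick_prob K \<tau> \<theta>" if "K \<le> CARD('n)" for K
  proof -
    have "measure M {\<omega> \<in> space M. d \<omega> \<in> thick_union K \<tau>} = measure (distr M lborel d) (thick_union K \<tau>)"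
      using assms(2) thick_union_sets[OF that]
      by (subst measure_distr) (auto intro!: arg_cong[of _ _ "measure M"])
    also have "\<dots> = measure lborel (level fd \<theta> \<inter> thick_union K \<tau>) / measure lborel (level fd \<theta>)"
      unfolding unif
    proof (rule measure_uniform_measure)
      show "emeasure lborel (level fd \<theta>) \<noteq> 0"
        using measure_level_pos[OF norms(2) \<open>0 < \<theta>\<close>] by (auto simp: measure_def)
      show "emeasure lborel (level fd \<theta>) \<noteq> \<infinity>"
        using emeasure_bounded_finite[OF compact_imp_bounded[OF compact_level[OF norms(2)]]]
        by (auto simp: less_top)
    qed (use thick_union_sets[OF that] in simp)
    finally show ?thesis
      by (simp add: thick_prob_def measure_level_scale[OF norms(2) \<open>0 < \<theta>\<close>] Int_commute)
  qed
  have sets: "{\<omega> \<in> space M. d \<omega> \<in> thick_union K \<tau>} \<in> sets M" if "K \<le> CARD('n)" for K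
    using thick_union_sets[OF that, of \<tau>] assms(2) by simp
  \<comment> \<open>Rewriting the value as a finite sum of indicators of events also settles its
    integrability.\<close>
  have "(\<integral>\<omega>. real (val_P I \<psi> nm \<tau> (d \<omega>)) \<partial>M) =
      (\<integral>\<omega>. (\<Sum>K = 0..CARD('n) - 1. 1 - indicator {\<omega> \<in> space M. d \<omega> \<in> thick_union K \<tau>} \<omega>) \<partial>M)"
    using \<open>0 < \<tau>\<close> by (intro Bochner_Integration.integral_cong) (auto simp: val_P_eq_sum indicator_def)
  also have "\<dots> = (\<Sum>K = 0..CARD('n) - 1. 1 - thick_prob K \<tau> \<theta>)"
    using le_N sets
    by (subst Bochner_Integration.integral_sum)
       (auto simp: prob prob_space emeasure_eq_measure Bochner_Integration.integral_diff intro!: sum.cong)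
  also have "\<dots> = real CARD('n) - (\<Sum>K = 0..CARD('n) - 1. thick_prob K \<tau> \<theta>)"
    using zero_less_card_finite[where 'a = 'n] by (simp add: sum_subtractf of_nat_diff)
  finally show ?thesis .
qed

end

subsection \<open>Asymptotics\<close>

text \<open>No signs are known, so \<open>f\<close> is compared with the sum of the absolute values
  of the two bounds.\<close>

lemma smallo_sandwich:
  fixes f g lo up :: "'b \<Rightarrow> real"
  assumes "eventually (\<lambda>x. lo x \<le> f x \<and> f x \<le> up x) F" "lo \<in> o[F](g)" "up \<in> o[F](g)"
  shows "f \<in> o[F](g)"
proof -
  have "(\<lambda>x. \<bar>lo x\<bar> + \<bar>up x\<bar>) \<in> o[F](g)"
    using assms(2,3) by (intro sum_in_smallo) simp_all
  moreover have "f \<in> O[F](\<lambda>x. \<bar>lo x\<bar> + \<bar>up x\<bar>)"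
    using assms(1) by (intro bigoI[of _ 1]) (auto elim!: eventually_mono)
  ultimately show ?thesis
    by (rule landau_o.big_small_trans[rotated])
qed

lemma ratio_to_0_filterlim: "filterlim (\<lambda>(\<tau>, \<theta>). \<tau> / \<theta>) (at_right 0) ratio_to_0"
  unfolding ratio_to_0_def by (rule filterlim_mono[OF filterlim_filtercomap order_refl inf_le1])

lemma eventually_ratio_to_0:
  assumes "eventually P (at_right 0)"
  shows "eventually (\<lambda>(\<tau>, \<theta>). 0 < \<tau> \<and> 0 < \<theta> \<and> P (\<tau> / \<theta>)) ratio_to_0"
proof -
  have "eventually (\<lambda>(\<tau>, \<theta>). P (\<tau> / \<theta>)) ratio_to_0"
    using eventually_compose_filterlim[OF assms ratio_to_0_filterlim] by (simp add: case_prod_unfold)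
  moreover have "eventually (\<lambda>(\<tau>, \<theta>). 0 < \<tau> \<and> 0 < \<theta>) ratio_to_0"
    unfolding ratio_to_0_def eventually_inf_principal by (auto intro: always_eventually)
  ultimately show ?thesis
    by eventually_elim auto
qed

lemma smallo_at_right_0I:
  fixes p :: "real \<Rightarrow> real"
  assumes "(p \<longlongrightarrow> 0) (at_right 0)"
  shows "(\<lambda>\<rho>. \<rho> * p \<rho>) \<in> o[at_right 0](\<lambda>\<rho>. \<rho>)"
proof (rule smalloI_tendsto)
  have nz: "eventually (\<lambda>\<rho>::real. \<rho> \<noteq> 0) (at_right 0)"
    by (simp add: eventually_at_filter)
  then show "((\<lambda>\<rho>. \<rho> * p \<rho> / \<rho>) \<longlongrightarrow> 0) (at_right 0)"
    by (intro Lim_transform_eventually[OF assms]) (rule eventually_mono[OF nz], simp)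
  show "eventually (\<lambda>\<rho>::real. \<rho> \<noteq> 0) (at_right 0)"
    by (rule nz)
qed

lemma smallo_higher_power:
  fixes a c :: real
  assumes "2 \<le> m"
  shows "(\<lambda>\<rho>. c * \<rho> ^ m * (1 + a * \<rho>) ^ k) \<in> o[at_right 0](\<lambda>\<rho>. \<rho>)"
proof -
  have "((\<lambda>\<rho>. c * \<rho> ^ (m - 1) * (1 + a * \<rho>) ^ k) \<longlongrightarrow> c * 0 ^ (m - 1) * (1 + a * 0) ^ k) (at_right 0)"
    by (intro tendsto_intros)
  then have "(\<lambda>\<rho>. \<rho> * (c * \<rho> ^ (m - 1) * (1 + a * \<rho>) ^ k)) \<in> o[at_right 0](\<lambda>\<rho>. \<rho>)"
    using assms by (intro smallo_at_right_0I) (simp add: power_0_left)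
  also have "(\<lambda>\<rho>. \<rho> * (c * \<rho> ^ (m - 1) * (1 + a * \<rho>) ^ k)) = (\<lambda>\<rho>. c * \<rho> ^ m * (1 + a * \<rho>) ^ k)"
    using assms by (cases m) (auto simp: fun_eq_iff)
  finally show ?thesis .
qed

lemma smallo_first_power:
  fixes a c :: real
  shows "(\<lambda>\<rho>. c * \<rho> - c * \<rho> ^ 1 * (1 + a * \<rho>) ^ k) \<in> o[at_right 0](\<lambda>\<rho>. \<rho>)"
proof -
  have "((\<lambda>\<rho>. c - c * (1 + a * \<rho>) ^ k) \<longlongrightarrow> c - c * (1 + a * 0) ^ k) (at_right 0)"
    by (intro tendsto_intros)
  then have "(\<lambda>\<rho>. \<rho> * (c - c * (1 + a * \<rho>) ^ k)) \<in> o[at_right 0](\<lambda>\<rho>. \<rho>)"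
    by (intro smallo_at_right_0I) simp
  then show ?thesis
    by (simp add: algebra_simps)
qed

text \<open>The exponent \<open>n - K\<close> is 1 for \<open>K = n - 1\<close> and at least 2
  below. The signs of \<open>a\<close> are arbitrary, so the lemma serves both bounds on the
  expectation.\<close>

lemma smallo_expansion:
  fixes a c :: "nat \<Rightarrow> real"
  assumes "0 < n"
  shows "(\<lambda>\<rho>. c (n - 1) * \<rho> - (\<Sum>K = 0..n - 1. c K * \<rho> ^ (n - K) * (1 + a K * \<rho>) ^ K))
    \<in> o[at_right 0](\<lambda>\<rho>. \<rho>)"
proof -
  let ?t = "\<lambda>K \<rho>. c K * \<rho> ^ (n - K) * (1 + a K * \<rho>) ^ K"
  have "{0..n - 1} = insert (n - 1) {0..<n - 1}"
    using assms by auto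
  then have eq: "c (n - 1) * \<rho> - (\<Sum>K = 0..n - 1. ?t K \<rho>) =
      (c (n - 1) * \<rho> - c (n - 1) * \<rho> ^ 1 * (1 + a (n - 1) * \<rho>) ^ (n - 1)) - (\<Sum>K = 0..<n - 1. ?t K \<rho>)" for \<rho>
    using assms by simp
  have "(\<lambda>\<rho>. \<Sum>K = 0..<n - 1. ?t K \<rho>) \<in> o[at_right 0](\<lambda>\<rho>. \<rho>)"
    by (intro big_sum_in_smallo smallo_higher_power) auto
  then show ?thesis
    unfolding eq by (rule sum_in_smallo(2)[OF smallo_first_power])
qed

context sparse_approximation
begin

text \<open>\<open>eps0\<close> in the single variable \<open>\<tau> / \<theta>\<close>, so that its
  order can be computed at 0 from the right and then composed with the ratio.\<close>

definition eps0_ratio :: "nat \<Rightarrow> real \<Rightarrow> real" where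
  "eps0_ratio K \<rho> = (if 0 < K \<and> K < CARD('n)
      then \<Sum>k = 2 * K - CARD('n)..K - 1.
             Q_bar \<psi> fd \<delta>2 \<J> K k * \<rho> ^ (CARD('n) - k) * (1 + delta_hat2 \<psi> \<J> \<delta>' K k * \<rho>) ^ k
      else 0)"

lemma eps0_eq: "eps0 \<psi> fd \<delta>2 \<J> \<delta>' K \<tau> \<theta> = eps0_ratio K (\<tau> / \<theta>)"
  by (simp add: eps0_def eps0_ratio_def)

text \<open>Here \<open>k \<le> K - 1\<close> and \<open>K < CARD('n)\<close>, so every exponent
  \<open>CARD('n) - k\<close> is at least 2.\<close>

lemma eps0_ratio_smallo: "(\<lambda>\<rho>. eps0_ratio K \<rho> / L) \<in> o[at_right 0](\<lambda>\<rho>. \<rho>)"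
proof (cases "0 < K \<and> K < CARD('n)")
  case True
  have "eps0_ratio K \<in> o[at_right 0](\<lambda>\<rho>. \<rho>)"
    unfolding eps0_ratio_def using True
    by (simp, intro big_sum_in_smallo smallo_higher_power) auto
  then show ?thesis
    using L_pos by simp
next
  case False
  then have "eps0_ratio K \<rho> = 0" for \<rho>
    by (auto simp: eps0_ratio_def)
  then show ?thesis
    by simp
qed

text \<open>For the empty index set the complement is the whole space, and a vector with positive
  \<open>fd\<close> forces \<open>\<delta> {}\<close> to be positive. Thus the condition
  \<open>\<theta> \<ge> \<tau> * Max\<close> already yields \<open>0 < \<theta>\<close>.\<close>

lemma Delta_max_pos: "0 < Max (Delta \<psi> \<J> \<delta> \<delta>' ` {0..CARD('n)})"
proof -
  obtain u :: "real^'n" where u: "u \<noteq> 0"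
    using zero_neq_one by metis
  have T0: "T \<psi> {} = {0}"
    by (simp add: T_def)
  have "0 < fd u"
    using is_norm_nonneg[OF norms(2), of u] is_norm_eq_0[OF norms(2), of u] u by simp
  also have "fd u \<le> \<delta> {} * h \<psi> nm {} u"
    using delta_J[of "{}"] by (simp add: T0)
  finally have "\<delta> {} \<noteq> 0"
    by auto
  then have "0 < \<delta> {}"
    using delta_J[of "{}"] by simp
  also have "\<delta> {} = Delta \<psi> \<J> \<delta> \<delta>' 0"
    by (simp add: delta_hat_def J_0)
  also have "\<dots> \<le> Max (Delta \<psi> \<J> \<delta> \<delta>' ` {0..CARD('n)})"
    by (intro Max_ge imageI) auto
  finally show ?thesis .
qed

end

text \<open>The probability space and the random variable are indexed by \<open>\<theta>\<close>,
  since the asymptotic claim lets \<open>\<theta>\<close> vary; only the law for each single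
  \<open>\<theta>\<close> is prescribed.\<close>

theorem theorem5:
  fixes I :: "'i set" and \<psi> :: "'i \<Rightarrow> real^'n"
    and nm fd :: "real^'n \<Rightarrow> real"
    and \<delta>1 \<delta>2 :: real
    and \<J> :: "nat \<Rightarrow> 'i set set"
    and \<delta> :: "'i set \<Rightarrow> real" and \<delta>' :: "'i set \<Rightarrow> 'i set \<Rightarrow> real"
    and M :: "real \<Rightarrow> 'w measure" and d :: "real \<Rightarrow> 'w \<Rightarrow> real^'n"
  assumes norms: "is_norm nm" "is_norm fd"
    and dictionary: "finite I" "span (\<psi> ` I) = UNIV"
    and delta1: "0 < \<delta>1" "\<And>w. fd w \<le> \<delta>1 * norm w"
    and delta2: "0 < \<delta>2" "\<And>w. norm w \<le> \<delta>2 * nm w"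
    and delta_J: "\<And>J. J \<subseteq> I \<Longrightarrow>
          0 \<le> \<delta> J \<and> \<delta> J \<le> \<delta>1 * \<delta>2 \<and> (\<forall>u\<in>(T \<psi> J)\<^sup>\<bottom>. fd u \<le> \<delta> J * h \<psi> nm J u)"
    and J: "representatives I \<psi> \<J>"
    and delta_J1_J2: "\<And>K k J1 J2. K \<le> CARD('n) \<Longrightarrow> k < K \<Longrightarrow> (J1, J2) \<in> H \<psi> \<J> K k \<Longrightarrow>
          0 \<le> \<delta>' J1 J2 \<and> \<delta>' J1 J2 \<le> 3 * (\<delta>1 * \<delta>2) \<and>
          (\<forall>\<tau>>0. \<forall>\<theta>>0. \<delta>' J1 J2 * \<tau> \<le> \<theta> \<longrightarrow>
             measure lborel (T_thick \<psi> nm \<tau> J1 \<inter> T_thick \<psi> nm \<tau> J2 \<inter> level fd \<theta>)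
             \<le> Q \<psi> fd \<delta>2 J1 J2 * \<tau> ^ (CARD('n) - k) * (\<theta> + \<delta>' J1 J2 * \<tau>) ^ k)"
    and uniform: "\<And>\<theta>. 0 < \<theta> \<Longrightarrow> prob_space (M \<theta>)"
          "\<And>\<theta>. 0 < \<theta> \<Longrightarrow> d \<theta> \<in> borel_measurable (M \<theta>)"
          "\<And>\<theta>. 0 < \<theta> \<Longrightarrow> distr (M \<theta>) lborel (d \<theta>) = uniform_measure lborel (level fd \<theta>)"
  defines "E \<equiv> \<lambda>\<tau> \<theta>. prob_space.expectation (M \<theta>) (\<lambda>\<omega>. real (val_P I \<psi> nm \<tau> (d \<theta> \<omega>)))"
    and "L \<equiv> measure lborel (level fd 1)"
  shows
    "(\<forall>\<tau>>0. \<forall>\<theta> \<ge> \<tau> * Max (Delta \<psi> \<J> \<delta> \<delta>' ` {0..CARD('n)}).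
        real CARD('n) - (\<Sum>K = 0..CARD('n) - 1.
            C_bar \<psi> nm fd \<J> K / L * (\<tau> / \<theta>) ^ (CARD('n) - K)
            * (1 + delta_hat \<J> \<delta> K * (\<tau> / \<theta>)) ^ K)
          \<le> E \<tau> \<theta>
      \<and> E \<tau> \<theta> \<le>
        real CARD('n) - (\<Sum>K = 0..CARD('n) - 1.
            C_bar \<psi> nm fd \<J> K / L * (\<tau> / \<theta>) ^ (CARD('n) - K)
            * (1 - delta_hat \<J> \<delta> K * (\<tau> / \<theta>)) ^ K
            - eps0 \<psi> fd \<delta>2 \<J> \<delta>' K \<tau> \<theta> / L))
    \<and> (\<lambda>(\<tau>, \<theta>). E \<tau> \<theta> - (real CARD('n) - C_bar \<psi> nm fd \<J> (CARD('n) - 1) / L * (\<tau> / \<theta>)))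
        \<in> o[ratio_to_0](\<lambda>(\<tau>, \<theta>). \<tau> / \<theta>)"
proof -
  interpret sparse_approximation I \<psi> nm fd \<delta>1 \<delta>2 \<J> \<delta> \<delta>'
    by (rule sparse_approximation.intro) (fact norms dictionary delta_J J delta_J1_J2)+
  define c where "c K = C_bar \<psi> nm fd \<J> K / L" for K
  define a where "a K = delta_hat \<J> \<delta> K" for K
  define D where "D = Max (Delta \<psi> \<J> \<delta> \<delta>' ` {0..CARD('n)})"
  \<comment> \<open>\<open>lo\<close> and \<open>up\<close> are subtracted from N and named after
    the bound on \<open>E\<close> that they produce: \<open>lo\<close> bounds the sum of the
    probabilities from above, \<open>up\<close> from below.\<close>
  define lo where "lo \<rho> = (\<Sum>K = 0..CARD('n) - 1. c K * \<rho> ^ (CARD('n) - K) * (1 + a K * \<rho>) ^ K)" for \<rho>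
  define up where "up \<rho> = (\<Sum>K = 0..CARD('n) - 1. c K * \<rho> ^ (CARD('n) - K) * (1 - a K * \<rho>) ^ K
      - eps0_ratio K \<rho> / L)" for \<rho>
  have bounds: "real CARD('n) - lo (\<tau> / \<theta>) \<le> E \<tau> \<theta>" "E \<tau> \<theta> \<le> real CARD('n) - up (\<tau> / \<theta>)"
    if \<tau>: "0 < \<tau>" and \<theta>: "\<tau> * D \<le> \<theta>" for \<tau> \<theta>
  proof -
    have \<theta>_pos: "0 < \<theta>"
      using mult_pos_pos[OF \<tau> Delta_max_pos] \<theta> by (simp add: D_def)
    have Delta: "\<tau> * Delta \<psi> \<J> \<delta> \<delta>' K \<le> \<theta>" if "K \<le> CARD('n)" for K
    proof -
      have "Delta \<psi> \<J> \<delta> \<delta>' K \<le> D"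
        unfolding D_def using that by (intro Max_ge) auto
      then show ?thesis
        using mult_left_mono[of _ D \<tau>] \<tau> \<theta> by (meson less_imp_le order.trans)
    qed
    have hat: "\<tau> * delta_hat \<J> \<delta> K \<le> \<theta>" if "K \<le> CARD('n)" for K
      using order.trans[OF mult_left_mono[OF delta_hat_le_Delta[OF that], of \<tau>] Delta[OF that]] \<tau> by simp
    have E: "E \<tau> \<theta> = real CARD('n) - (\<Sum>K = 0..CARD('n) - 1. thick_prob K \<tau> \<theta>)"
      unfolding E_def using uniform \<theta>_pos \<tau> by (intro expectation_val_P)
    have "(\<Sum>K = 0..CARD('n) - 1. thick_prob K \<tau> \<theta>) \<le> lo (\<tau> / \<theta>)"
      unfolding lo_def c_def a_def L_def using hat \<tau> \<theta>_pos
      by (intro sum_mono thick_prob_upper) auto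
    moreover have "up (\<tau> / \<theta>) \<le> (\<Sum>K = 0..CARD('n) - 1. thick_prob K \<tau> \<theta>)"
      unfolding up_def c_def a_def L_def
    proof (rule sum_mono)
      fix K assume "K \<in> {0..CARD('n) - 1}"
      then have "K < CARD('n)"
        using le_less_trans[of K "CARD('n) - 1" "CARD('n)"] by simp
      then show "C_bar \<psi> nm fd \<J> K / measure lborel (level fd 1) * (\<tau> / \<theta>) ^ (CARD('n) - K) *
          (1 - delta_hat \<J> \<delta> K * (\<tau> / \<theta>)) ^ K - eps0_ratio K (\<tau> / \<theta>) / measure lborel (level fd 1)
          \<le> thick_prob K \<tau> \<theta>"
        using thick_prob_lower[of K \<tau> \<theta>] Delta[of K] \<tau> \<theta>_pos by (simp add: eps0_eq)
    qed
    ultimately show "real CARD('n) - lo (\<tau> / \<theta>) \<le> E \<tau> \<theta>" "E \<tau> \<theta> \<le> real CARD('n) - up (\<tau> / \<theta>)"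
      unfolding E by simp_all
  qed
  let ?c = "c (CARD('n) - 1)"
  have lo_o: "(\<lambda>\<rho>. ?c * \<rho> - lo \<rho>) \<in> o[at_right 0](\<lambda>\<rho>. \<rho>)"
    unfolding lo_def by (rule smallo_expansion) simp
  have up_o: "(\<lambda>\<rho>. ?c * \<rho> - up \<rho>) \<in> o[at_right 0](\<lambda>\<rho>. \<rho>)"
  proof -
    have "(\<lambda>\<rho>. \<Sum>K = 0..CARD('n) - 1. eps0_ratio K \<rho> / L) \<in> o[at_right 0](\<lambda>\<rho>. \<rho>)"
      unfolding L_def by (intro big_sum_in_smallo eps0_ratio_smallo)
    moreover have "(\<lambda>\<rho>. ?c * \<rho> - (\<Sum>K = 0..CARD('n) - 1. c K * \<rho> ^ (CARD('n) - K) * (1 + (- a K) * \<rho>) ^ K))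
        \<in> o[at_right 0](\<lambda>\<rho>. \<rho>)"
      by (rule smallo_expansion) simp
    ultimately have "(\<lambda>\<rho>. (?c * \<rho> - (\<Sum>K = 0..CARD('n) - 1. c K * \<rho> ^ (CARD('n) - K) * (1 + (- a K) * \<rho>) ^ K))
        + (\<Sum>K = 0..CARD('n) - 1. eps0_ratio K \<rho> / L)) \<in> o[at_right 0](\<lambda>\<rho>. \<rho>)"
      by (rule sum_in_smallo(1)[rotated])
    then show ?thesis
      by (simp add: up_def sum_subtractf algebra_simps)
  qed
  have "(\<lambda>(\<tau>, \<theta>). E \<tau> \<theta> - (real CARD('n) - ?c * (\<tau> / \<theta>))) \<in> o[ratio_to_0](\<lambda>(\<tau>, \<theta>). \<tau> / \<theta>)"
  proof (rule smallo_sandwich)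
    let ?r = "\<lambda>(\<tau>, \<theta>). \<tau> / \<theta> :: real"
    show "(\<lambda>p. ?c * ?r p - lo (?r p)) \<in> o[ratio_to_0](?r)"
      using landau_o.small.compose[OF lo_o ratio_to_0_filterlim] .
    show "(\<lambda>p. ?c * ?r p - up (?r p)) \<in> o[ratio_to_0](?r)"
      using landau_o.small.compose[OF up_o ratio_to_0_filterlim] .
    \<comment> \<open>The hypothesis \<open>\<tau> * D \<le> \<theta>\<close> depends on the ratio
      only, so both bounds hold eventually along \<open>ratio_to_0\<close>.\<close>
    have "eventually (\<lambda>\<rho>. \<rho> * D < 1) (at_right 0)"
    proof (rule order_tendstoD(2))
      show "((\<lambda>\<rho>. \<rho> * D) \<longlongrightarrow> 0 * D) (at_right 0)"
        by (intro tendsto_intros)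
    qed simp
    then have "eventually (\<lambda>(\<tau>, \<theta>). 0 < \<tau> \<and> 0 < \<theta> \<and> \<tau> / \<theta> * D < 1) ratio_to_0"
      by (rule eventually_ratio_to_0)
    then show "eventually (\<lambda>p. ?c * ?r p - lo (?r p) \<le>
          (case p of (\<tau>, \<theta>) \<Rightarrow> E \<tau> \<theta> - (real CARD('n) - ?c * (\<tau> / \<theta>))) \<and>
        (case p of (\<tau>, \<theta>) \<Rightarrow> E \<tau> \<theta> - (real CARD('n) - ?c * (\<tau> / \<theta>))) \<le> ?c * ?r p - up (?r p)) ratio_to_0"
    proof (rule eventually_mono, clarify)
      fix \<tau> \<theta> :: real assume *: "0 < \<tau>" "0 < \<theta>" "\<tau> / \<theta> * D < 1"
      then have "\<tau> * D \<le> \<theta>"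
        by (simp add: field_simps)
      from bounds[OF *(1) this]
      show "?c * (\<tau> / \<theta>) - lo (\<tau> / \<theta>) \<le> E \<tau> \<theta> - (real CARD('n) - ?c * (\<tau> / \<theta>)) \<and>
          E \<tau> \<theta> - (real CARD('n) - ?c * (\<tau> / \<theta>)) \<le> ?c * (\<tau> / \<theta>) - up (\<tau> / \<theta>)"
        by linarith
    qed
  qed
  then show ?thesis
    using bounds unfolding lo_def up_def c_def a_def D_def eps0_eq by blast
qed

end
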